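(* There exists a universal constant $C>0$ such that for every $n\ge1$ and every subspace $\mathsf A\subset(\mathbb C^2)^{\otimes n}$ with orthogonal projection $P_{\mathsf A}$ onto $\mathsf A$ and $\tau(\mathsf A)=2^{-n}\operatorname{tr}(P_{\mathsf A})$, $$\max_{1\le j\le n}\|d_j P_{\mathsf A}\|_1\ge\frac Cn\,\tau(\mathsf A)(1-\tau(\mathsf A))\left(\log\frac{n}{\tau(\mathsf A)(1-\tau(\mathsf A))}\right)^{1/2}.$$
   Context: On $M_2(\mathbb{C})^{\otimes n}\cong M_{2^n}(\mathbb{C})$ (trace $\operatorname{tr}$, identity $\mathbf 1$), $\|A\|_1=2^{-n}\operatorname{tr}|A|$ and, for $1\le j\le n$, $d_j=\mathbb I^{\otimes(j-1)}\otimes(\mathbb I-\tfrac12\operatorname{tr}(\cdot)\mathbf 1)\otimes\mathbb I^{\otimes(n-j)}$, where $\mathbb I$ is the identity map on $M_2(\mathbb{C})$. The right-hand side is interpreted as $0$ when $\tau(\mathsf A)\in\{0,1\}$. *)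

theory Defs
  imports "Jordan_Normal_Form.Schur_Decomposition" "Jordan_Normal_Form.VS_Connect"
begin

(* Conventions. (C^2)^{(x) n} is carrier_vec (2 ^ n) and M_2(C)^{(x) n} is carrier_mat (2 ^ n) (2 ^ n),
   both over complex, via the Kronecker product: index i * b + k of a product space
   with factors of dimension a and b stands for the basis vector e_i (x) e_k. *)

definition mat_trace :: "complex mat \<Rightarrow> complex" where
  "mat_trace A = (\<Sum>i<dim_row A. A $$ (i, i))"

definition kron :: "complex mat \<Rightarrow> complex mat \<Rightarrow> complex mat" where
  "kron A B = mat (dim_row A * dim_row B) (dim_col A * dim_col B)
     (\<lambda>(i, j). A $$ (i div dim_row B, j div dim_col B) * B $$ (i mod dim_row B, j mod dim_col B))"

definition mat_unit :: "nat \<Rightarrow> nat \<Rightarrow> nat \<Rightarrow> complex mat" where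
  "mat_unit N i j = mat N N (\<lambda>(r, s). if r = i \<and> s = j then 1 else 0)"

(* The tensor product S (x) T of linear maps S on M_a(C) and T on M_b(C): a matrix A of size a * b is
   expanded in the basis E_ij (x) E_kl, which S (x) T sends to S E_ij (x) T E_kl.
   Lemma tensor_map_kron below is the defining property on elementary tensors; d_map_kron is its
   instance for d_j. *)
definition tensor_map ::
    "nat \<Rightarrow> nat \<Rightarrow> (complex mat \<Rightarrow> complex mat) \<Rightarrow> (complex mat \<Rightarrow> complex mat) \<Rightarrow> complex mat \<Rightarrow> complex mat"
  where
  "tensor_map a b S T A = mat (a * b) (a * b) (\<lambda>(r, s).
     \<Sum>i<a. \<Sum>j<a. \<Sum>k<b. \<Sum>l<b.
       A $$ (i * b + k, j * b + l) * kron (S (mat_unit a i j)) (T (mat_unit b k l)) $$ (r, s))"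

definition traceless_part :: "complex mat \<Rightarrow> complex mat" where
  "traceless_part X = X - (mat_trace X / 2) \<cdot>\<^sub>m 1\<^sub>m 2"

(* The identity on M_2(C)^{(x) k} is the identity map on matrices of size 2 ^ k. *)
definition d_map :: "nat \<Rightarrow> nat \<Rightarrow> complex mat \<Rightarrow> complex mat" where
  "d_map n j = tensor_map (2 ^ (j - 1) * 2) (2 ^ (n - j))
     (tensor_map (2 ^ (j - 1)) 2 (\<lambda>X. X) traceless_part) (\<lambda>X. X)"

definition psd_mat :: "nat \<Rightarrow> complex mat \<Rightarrow> bool" where
  "psd_mat N A \<longleftrightarrow> A \<in> carrier_mat N N \<and> mat_adjoint A = A \<and>
     (\<forall>v \<in> carrier_vec N. 0 \<le> Re ((A *\<^sub>v v) \<bullet>c v))"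

(* |A| is the unique positive semidefinite square root of A^* A, for square A. *)
definition mat_abs :: "complex mat \<Rightarrow> complex mat" where
  "mat_abs A = (THE B. psd_mat (dim_row A) B \<and> B * B = mat_adjoint A * A)"

definition norm1 :: "nat \<Rightarrow> complex mat \<Rightarrow> real" where
  "norm1 n A = Re (mat_trace (mat_abs A)) / 2 ^ n"

definition is_subspace :: "nat \<Rightarrow> complex vec set \<Rightarrow> bool" where
  "is_subspace n W \<longleftrightarrow> VectorSpace.subspace class_ring W (module_vec TYPE(complex) (2 ^ n))"

definition orth_proj :: "nat \<Rightarrow> complex vec set \<Rightarrow> complex mat" where
  "orth_proj n W = (THE P. P \<in> carrier_mat (2 ^ n) (2 ^ n) \<and>
     (\<forall>v \<in> carrier_vec (2 ^ n). P *\<^sub>v v \<in> W \<and> (\<forall>w \<in> W. (v - P *\<^sub>v v) \<bullet>c w = 0)))"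

definition tau :: "nat \<Rightarrow> complex vec set \<Rightarrow> real" where
  "tau n W = Re (mat_trace (orth_proj n W)) / 2 ^ n"

lemma kron_index:
  assumes "A \<in> carrier_mat a a" "B \<in> carrier_mat b b" "r < a * b" "s < a * b"
  shows "kron A B $$ (r, s) = A $$ (r div b, s div b) * B $$ (r mod b, s mod b)"
  using assms unfolding kron_def by auto

lemma pair_index_less:
  fixes i k a b :: nat
  assumes "i < a" "k < b" shows "i * b + k < a * b"
proof -
  have "i * b + k < Suc i * b" using assms by simp
  also have "\<dots> \<le> a * b" using assms by (intro mult_right_mono) auto
  finally show ?thesis .
qed

lemma tensor_map_kron:
  assumes A: "A \<in> carrier_mat a a" and B: "B \<in> carrier_mat b b"
    and S: "\<And>X. X \<in> carrier_mat a a \<Longrightarrow> S X \<in> carrier_mat a a"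
    and T: "\<And>X. X \<in> carrier_mat b b \<Longrightarrow> T X \<in> carrier_mat b b"
    and S_lin: "\<And>X r s. X \<in> carrier_mat a a \<Longrightarrow> r < a \<Longrightarrow> s < a \<Longrightarrow>
          S X $$ (r, s) = (\<Sum>i<a. \<Sum>j<a. X $$ (i, j) * S (mat_unit a i j) $$ (r, s))"
    and T_lin: "\<And>X r s. X \<in> carrier_mat b b \<Longrightarrow> r < b \<Longrightarrow> s < b \<Longrightarrow>
          T X $$ (r, s) = (\<Sum>k<b. \<Sum>l<b. X $$ (k, l) * T (mat_unit b k l) $$ (r, s))"
  shows "tensor_map a b S T (kron A B) = kron (S A) (T B)"
proof (rule eq_matI)
  have SA: "S A \<in> carrier_mat a a" and TB: "T B \<in> carrier_mat b b" using A B S T by auto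
  show "dim_row (tensor_map a b S T (kron A B)) = dim_row (kron (S A) (T B))"
    "dim_col (tensor_map a b S T (kron A B)) = dim_col (kron (S A) (T B))"
    using SA TB by (auto simp: tensor_map_def kron_def)
  fix r s assume "r < dim_row (kron (S A) (T B))" "s < dim_col (kron (S A) (T B))"
  then have rs: "r < a * b" "s < a * b" using SA TB by (auto simp: kron_def)
  then have b: "b > 0" by (cases b) auto
  have rs': "r div b < a" "s div b < a" "r mod b < b" "s mod b < b"
    using rs b by (auto simp: less_mult_imp_div_less)
  have mu: "mat_unit a i j \<in> carrier_mat a a" "mat_unit b i j \<in> carrier_mat b b" for i j
    by (auto simp: mat_unit_def)
  have "tensor_map a b S T (kron A B) $$ (r, s) = (\<Sum>i<a. \<Sum>j<a. \<Sum>k<b. \<Sum>l<b.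
      (A $$ (i, j) * S (mat_unit a i j) $$ (r div b, s div b)) *
      (B $$ (k, l) * T (mat_unit b k l) $$ (r mod b, s mod b)))"
    unfolding tensor_map_def using rs
    by (auto intro!: sum.cong simp: kron_index[OF A B] kron_index[OF S[OF mu(1)] T[OF mu(2)]]
        pair_index_less mult_ac)
  also have "\<dots> = S A $$ (r div b, s div b) * T B $$ (r mod b, s mod b)"
    unfolding S_lin[OF A rs'(1,2)] T_lin[OF B rs'(3,4)]
    by (simp add: sum_distrib_left[symmetric] sum_distrib_right[symmetric])
  also have "\<dots> = kron (S A) (T B) $$ (r, s)" using kron_index[OF SA TB rs] by simp
  finally show "tensor_map a b S T (kron A B) $$ (r, s) = kron (S A) (T B) $$ (r, s)" .
qed

lemma sum_mat_unit:
  assumes "r < a" "s < a"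
  shows "(\<Sum>i<a. \<Sum>j<a. f i j * mat_unit a i j $$ (r, s)) = f r s"
proof -
  have "(\<Sum>i<a. \<Sum>j<a. f i j * mat_unit a i j $$ (r, s)) =
      (\<Sum>i<a. \<Sum>j<a. if j = s then if i = r then f i j else 0 else 0)"
    using assms by (intro sum.cong refl) (auto simp: mat_unit_def)
  also have "\<dots> = f r s" using assms by (simp add: sum.delta)
  finally show ?thesis .
qed

lemma mat_trace_mat_unit:
  assumes "i < a" shows "mat_trace (mat_unit a i j) = (if i = j then 1 else 0)"
proof -
  have "mat_trace (mat_unit a i j) = (\<Sum>r<a. if r = i then if i = j then 1 else 0 else 0)"
    unfolding mat_trace_def mat_unit_def using assms by (intro sum.cong) auto
  then show ?thesis using assms by (simp add: sum.delta)
qed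

lemma traceless_part_expand:
  assumes X: "X \<in> carrier_mat 2 2" and rs: "r < 2" "s < 2"
  shows "traceless_part X $$ (r, s) =
    (\<Sum>i<2. \<Sum>j<2. X $$ (i, j) * traceless_part (mat_unit 2 i j) $$ (r, s))"
proof -
  have m: "mat_unit 2 i j \<in> carrier_mat 2 2" for i j by (simp add: mat_unit_def)
  have e: "traceless_part Y $$ (r, s) = Y $$ (r, s) - mat_trace Y / 2 * (if r = s then 1 else 0)"
    if "Y \<in> carrier_mat 2 2" for Y
    using that rs by (auto simp: traceless_part_def)
  have "(\<Sum>i<2. \<Sum>j<2. X $$ (i, j) * traceless_part (mat_unit 2 i j) $$ (r, s)) =
      (\<Sum>i<2. \<Sum>j<2. X $$ (i, j) * mat_unit 2 i j $$ (r, s))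
      - (\<Sum>i<2. \<Sum>j<2. if j = i then X $$ (i, j) else 0) / 2 * (if r = s then 1 else 0)"
    unfolding e[OF m] sum_distrib_right sum_divide_distrib sum_subtractf[symmetric]
    by (intro sum.cong refl) (auto simp: mat_trace_mat_unit algebra_simps)
  also have "\<dots> = traceless_part X $$ (r, s)"
    unfolding sum_mat_unit[OF rs] e[OF X] using X by (simp add: mat_trace_def)
  finally show ?thesis by simp
qed

lemma tensor_map_expand:
  assumes rs: "r < a * b" "s < a * b"
  shows "tensor_map a b S T X $$ (r, s) =
    (\<Sum>i<a * b. \<Sum>j<a * b. X $$ (i, j) * tensor_map a b S T (mat_unit (a * b) i j) $$ (r, s))"
proof -
  let ?K = "\<lambda>i j k l. kron (S (mat_unit a i j)) (T (mat_unit b k l)) $$ (r, s)"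
  have "(\<Sum>p<a * b. \<Sum>q<a * b. X $$ (p, q) * tensor_map a b S T (mat_unit (a * b) p q) $$ (r, s)) =
      (\<Sum>p<a * b. \<Sum>q<a * b. \<Sum>i<a. \<Sum>j<a. \<Sum>k<b. \<Sum>l<b.
        X $$ (p, q) * mat_unit (a * b) p q $$ (i * b + k, j * b + l) * ?K i j k l)"
    unfolding tensor_map_def using rs by (simp add: sum_distrib_left mult.assoc)
  also have "\<dots> = (\<Sum>i<a. \<Sum>j<a. \<Sum>k<b. \<Sum>l<b. (\<Sum>p<a * b. \<Sum>q<a * b.
        X $$ (p, q) * mat_unit (a * b) p q $$ (i * b + k, j * b + l)) * ?K i j k l)"
    unfolding sum_distrib_right
    by (simp only: sum.swap[where A = "{..<a * b}" and B = "{..<a}"]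
        sum.swap[where A = "{..<a * b}" and B = "{..<b}"])
  also have "\<dots> = tensor_map a b S T X $$ (r, s)"
    unfolding tensor_map_def using rs by (auto intro!: sum.cong simp: sum_mat_unit pair_index_less)
  finally show ?thesis by simp
qed

lemma d_map_kron:
  assumes A: "A \<in> carrier_mat (2 ^ (j - 1)) (2 ^ (j - 1))" and X: "X \<in> carrier_mat 2 2"
    and B: "B \<in> carrier_mat (2 ^ (n - j)) (2 ^ (n - j))"
  shows "d_map n j (kron (kron A X) B) = kron (kron A (traceless_part X)) B"
proof -
  have c: "tensor_map p q S T M \<in> carrier_mat (p * q) (p * q)" for p q S T M
    by (simp add: tensor_map_def)
  have t: "traceless_part Y \<in> carrier_mat 2 2" if "Y \<in> carrier_mat 2 2" for Y
    using that by (auto simp: traceless_part_def)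
  have k: "kron A X \<in> carrier_mat (2 ^ (j - 1) * 2) (2 ^ (j - 1) * 2)"
    using A X by (auto simp: kron_def)
  have "tensor_map (2 ^ (j - 1)) 2 (\<lambda>X. X) traceless_part (kron A X) = kron A (traceless_part X)"
    by (rule tensor_map_kron[OF A X _ t]) (simp_all add: sum_mat_unit traceless_part_expand[symmetric])
  moreover have "d_map n j (kron (kron A X) B) =
      kron (tensor_map (2 ^ (j - 1)) 2 (\<lambda>X. X) traceless_part (kron A X)) B"
    unfolding d_map_def
    by (rule tensor_map_kron[OF k B c]) (simp_all add: sum_mat_unit tensor_map_expand[symmetric])
  ultimately show ?thesis by simp
qed

end

theory Submission
  imports Defs "Jordan_Normal_Form.Spectral_Radius" "HOL-Analysis.Convex"
begin

text \<open>
Expand the projection \<open>P\<close> in the Pauli basis as \<open>P = \<Sum>\<^sub>s p\<^sub>s \<sigma>\<^sub>s\<close> with real \<open>p\<^sub>s\<close>. Then \<open>d_j\<close> keeps the strings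
with \<open>s\<^sub>j \<noteq> 0\<close>, and \<open>\<tau> (1 - \<tau>)\<close> is the sum of \<open>p\<^sub>s\<^sup>2\<close> over \<open>s \<noteq> 0\<close>. Let \<open>I_j\<close> be the norm of \<open>d_j P\<close> in question.

The trace inner product of \<open>P\<close> with \<open>d_j P\<close> is \<open>\<parallel>d_j P\<parallel>\<^sub>2\<^sup>2\<close>, so duality with \<open>0 \<le> P \<le> 1\<close> gives \<open>\<parallel>d_j P\<parallel>\<^sub>2\<^sup>2 \<le> I_j\<close>.
Let \<open>T\<close> multiply \<open>\<sigma>\<^sub>s\<close> by \<open>4\<close> to the power minus the weight of \<open>s\<close>. It is a contraction from the \<open>2\<close>-norm to
the \<open>4\<close>-norm, by induction over the tensor factors, and by duality
\<open>\<parallel>T d_j P\<parallel>\<^sub>2\<^sup>2 \<le> \<parallel>d_j P\<parallel>\<^sub>1 \<parallel>d_j P\<parallel>\<^sub>2 \<le> I_j powr (3 / 2)\<close>.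
Summing over \<open>j\<close>, the first estimate controls the weight of \<open>P\<close> on levels above a threshold \<open>K\<close> and the second
one the weight below it: with \<open>M\<close> the largest \<open>I_j\<close>,
\<open>\<tau> (1 - \<tau>) \<le> n M / K + 16 powr K * n M powr (3 / 2)\<close>. Taking \<open>K\<close> a small multiple of
\<open>ln (n / (\<tau> (1 - \<tau>)))\<close> yields the bound.
\<close>

section \<open>Adjoints, traces and Hermitian matrices\<close>

lemma mat_adjoint_index [simp]:
  "i < dim_col A \<Longrightarrow> j < dim_row A \<Longrightarrow> mat_adjoint A $$ (i, j) = conjugate (A $$ (j, i))"
  unfolding mat_adjoint_def by (auto simp: mat_of_rows_def)

lemma mat_adjoint_dim [simp]:
  "dim_row (mat_adjoint A) = dim_col A" "dim_col (mat_adjoint A) = dim_row A"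
  unfolding mat_adjoint_def by auto

lemma mat_adjoint_carrier [simp]:
  "A \<in> carrier_mat m n \<Longrightarrow> mat_adjoint A \<in> carrier_mat n m"
  by (auto intro: carrier_matI)

lemma mat_adjoint_adjoint [simp]: "mat_adjoint (mat_adjoint A) = A"
  by (rule eq_matI) auto

lemma mat_adjoint_mult:
  fixes A B :: "'a :: conjugatable_field mat"
  assumes "A \<in> carrier_mat m n" "B \<in> carrier_mat n k"
  shows "mat_adjoint (A * B) = mat_adjoint B * mat_adjoint A"
  using assms
  by (intro eq_matI)
    (auto simp: scalar_prod_def sum_conjugate conjugate_dist_mul mult.commute intro!: sum.cong)

lemma mat_adjoint_add:
  fixes A B :: "'a :: conjugatable_field mat"
  assumes "A \<in> carrier_mat m n" "B \<in> carrier_mat m n"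
  shows "mat_adjoint (A + B) = mat_adjoint A + mat_adjoint B"
  using assms by (intro eq_matI) (auto simp: conjugate_dist_add)

lemma mat_adjoint_smult:
  fixes A :: "'a :: conjugatable_field mat"
  shows "mat_adjoint (c \<cdot>\<^sub>m A) = conjugate c \<cdot>\<^sub>m mat_adjoint A"
  by (intro eq_matI) (auto simp: conjugate_dist_mul)

lemma mat_adjoint_minus:
  fixes A B :: "complex mat"
  assumes "A \<in> carrier_mat m n" "B \<in> carrier_mat m n"
  shows "mat_adjoint (A - B) = mat_adjoint A - mat_adjoint B"
  using assms by (intro eq_matI) auto

lemma mat_trace_add:
  "A \<in> carrier_mat N N \<Longrightarrow> B \<in> carrier_mat N N \<Longrightarrow> mat_trace (A + B) = mat_trace A + mat_trace B"
  unfolding mat_trace_def by (auto simp: sum.distrib)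

lemma mat_trace_minus:
  "A \<in> carrier_mat N N \<Longrightarrow> B \<in> carrier_mat N N \<Longrightarrow> mat_trace (A - B) = mat_trace A - mat_trace B"
  unfolding mat_trace_def by (auto simp: sum_subtractf)

lemma mat_trace_smult:
  "A \<in> carrier_mat N N \<Longrightarrow> mat_trace (c \<cdot>\<^sub>m A) = c * mat_trace A"
  unfolding mat_trace_def by (auto simp: sum_distrib_left)

lemma mat_trace_mult:
  assumes "A \<in> carrier_mat m n" "B \<in> carrier_mat n m"
  shows "mat_trace (A * B) = (\<Sum>i<m. \<Sum>j<n. A $$ (i, j) * B $$ (j, i))"
  using assms unfolding mat_trace_def by (auto simp: scalar_prod_def atLeast0LessThan intro!: sum.cong)

lemma mat_trace_comm:
  assumes "A \<in> carrier_mat m n" "B \<in> carrier_mat n m"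
  shows "mat_trace (A * B) = mat_trace (B * A)"
  unfolding mat_trace_mult[OF assms] mat_trace_mult[OF assms(2,1)]
  by (subst sum.swap) (simp add: mult.commute)

lemma sum_lessThan_add:
  fixes f :: "nat \<Rightarrow> 'a :: comm_monoid_add"
  shows "(\<Sum>i<m + n. f i) = (\<Sum>i<m. f i) + (\<Sum>i<n. f (m + i))"
  by (induct n) (auto simp: add.assoc)

lemma mat_trace_four_block:
  assumes A: "A \<in> carrier_mat m m" and D: "D \<in> carrier_mat n n"
  shows "mat_trace (four_block_mat A B C D) = mat_trace A + mat_trace D"
proof -
  have "mat_trace (four_block_mat A B C D) = (\<Sum>i<m + n. four_block_mat A B C D $$ (i, i))"
    using A D unfolding mat_trace_def by simp
  also have "\<dots> = (\<Sum>i<m. A $$ (i, i)) + (\<Sum>i<n. D $$ (i, i))"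
    unfolding sum_lessThan_add using A D by (intro arg_cong2[where f = plus] sum.cong) auto
  finally show ?thesis using A D unfolding mat_trace_def by simp
qed

lemma mat_trace_adjoint_mult:
  assumes "A \<in> carrier_mat m n"
  shows "mat_trace (mat_adjoint A * A) = of_real (\<Sum>i<m. \<Sum>j<n. (cmod (A $$ (i, j)))\<^sup>2)"
proof -
  have "mat_trace (mat_adjoint A * A) = (\<Sum>j<n. \<Sum>i<m. of_real ((cmod (A $$ (i, j)))\<^sup>2))"
    using assms by (subst mat_trace_mult[of _ n m]) (auto simp: complex_norm_square mult.commute simp del: of_real_power intro!: sum.cong)
  also have "\<dots> = of_real (\<Sum>i<m. \<Sum>j<n. (cmod (A $$ (i, j)))\<^sup>2)"
    by (subst sum.swap) simp
  finally show ?thesis .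
qed

lemma mat_trace_adjoint_mult_nonneg:
  assumes "A \<in> carrier_mat m n"
  shows "0 \<le> Re (mat_trace (mat_adjoint A * A))"
  unfolding mat_trace_adjoint_mult[OF assms] by (simp add: sum_nonneg)

section \<open>Hermitian matrices and the real trace as their inner product\<close>

definition herm :: "nat \<Rightarrow> complex mat \<Rightarrow> bool" where
  "herm N A \<longleftrightarrow> A \<in> carrier_mat N N \<and> mat_adjoint A = A"

lemma herm_carrier [simp]: "herm N A \<Longrightarrow> A \<in> carrier_mat N N"
  unfolding herm_def by auto

lemma herm_adjoint [simp]: "herm N A \<Longrightarrow> mat_adjoint A = A"
  unfolding herm_def by auto

lemma herm_index: "herm N A \<Longrightarrow> i < N \<Longrightarrow> j < N \<Longrightarrow> A $$ (i, j) = cnj (A $$ (j, i))"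
  by (metis carrier_matD conjugate_complex_def herm_def mat_adjoint_index)

lemma herm_add [simp]: "herm N A \<Longrightarrow> herm N B \<Longrightarrow> herm N (A + B)"
  unfolding herm_def by (auto simp: mat_adjoint_add)

lemma herm_minus [simp]: "herm N A \<Longrightarrow> herm N B \<Longrightarrow> herm N (A - B)"
  unfolding herm_def by (auto simp: mat_adjoint_minus)

lemma herm_smult [simp]: "herm N A \<Longrightarrow> herm N (complex_of_real c \<cdot>\<^sub>m A)"
  unfolding herm_def by (auto simp: mat_adjoint_smult)

lemma herm_square [simp]: "herm N A \<Longrightarrow> herm N (A * A)"
  unfolding herm_def by (auto simp: mat_adjoint_mult)

lemma herm_conj:
  assumes A: "herm N A" and U: "U \<in> carrier_mat N M"
  shows "herm M (mat_adjoint U * A * U)"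
proof -
  have c: "mat_adjoint U \<in> carrier_mat M N" "A \<in> carrier_mat N N" "mat_adjoint A = A"
    using A U unfolding herm_def by simp_all
  have "mat_adjoint (mat_adjoint U * A * U) = mat_adjoint U * (A * U)"
    using mat_adjoint_mult[OF mult_carrier_mat[OF c(1,2)] U] mat_adjoint_mult[OF c(1,2)] c(3) by simp
  also have "\<dots> = mat_adjoint U * A * U"
    using assoc_mult_mat[OF c(1,2) U] by simp
  finally show ?thesis
    using mult_carrier_mat[OF mult_carrier_mat[OF c(1,2)] U] unfolding herm_def by simp
qed

lemma herm_diag: "herm N A \<Longrightarrow> i < N \<Longrightarrow> Im (A $$ (i, i)) = 0"
  using herm_index[of N A i i] by (simp add: complex_eq_iff)

text \<open>On Hermitian matrices \<open>rtr (A * B)\<close> is the Hilbert-Schmidt inner product.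
  Taking real parts turns all later trace estimates into inequalities between reals.\<close>

definition rtr :: "complex mat \<Rightarrow> real" where
  "rtr A = Re (mat_trace A)"

lemma rtr_add: "A \<in> carrier_mat N N \<Longrightarrow> B \<in> carrier_mat N N \<Longrightarrow> rtr (A + B) = rtr A + rtr B"
  unfolding rtr_def by (simp add: mat_trace_add)

lemma rtr_minus: "A \<in> carrier_mat N N \<Longrightarrow> B \<in> carrier_mat N N \<Longrightarrow> rtr (A - B) = rtr A - rtr B"
  unfolding rtr_def by (simp add: mat_trace_minus)

lemma rtr_smult: "A \<in> carrier_mat N N \<Longrightarrow> rtr (complex_of_real c \<cdot>\<^sub>m A) = c * rtr A"
  unfolding rtr_def by (simp add: mat_trace_smult)

lemma rtr_comm: "A \<in> carrier_mat m n \<Longrightarrow> B \<in> carrier_mat n m \<Longrightarrow> rtr (A * B) = rtr (B * A)"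
  unfolding rtr_def using mat_trace_comm by simp

lemma rtr_square_nonneg: "herm N A \<Longrightarrow> 0 \<le> rtr (A * A)"
  using mat_trace_adjoint_mult_nonneg[of A N N] unfolding rtr_def by simp

text \<open>For Hermitian matrices \<open>rtr (A * B)\<close> is the Euclidean inner product of the
  real and imaginary parts of the entries. Hence \<open>q t\<close>, the squared norm of
  \<open>A + t B\<close>, is a nonnegative quadratic polynomial, which forces the discriminant
  inequality.\<close>

lemma rtr_Cauchy_Schwarz:
  assumes A: "herm N A" and B: "herm N B"
  shows "(rtr (A * B))\<^sup>2 \<le> rtr (A * A) * rtr (B * B)"
proof -
  have e: "rtr (X * Y) = (\<Sum>p\<in>{..<N} \<times> {..<N}. Re (X $$ p) * Re (Y $$ p)) +
      (\<Sum>p\<in>{..<N} \<times> {..<N}. Im (X $$ p) * Im (Y $$ p))" if "herm N X" "herm N Y" for X Y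
  proof -
    have "rtr (X * Y) = (\<Sum>i<N. \<Sum>j<N. Re (X $$ (i, j) * cnj (Y $$ (i, j))))"
      unfolding rtr_def mat_trace_mult[OF herm_carrier[OF that(1)] herm_carrier[OF that(2)]] Re_sum
    proof (intro sum.cong refl)
      fix i j assume "i \<in> {..<N}" "j \<in> {..<N}"
      then show "Re (X $$ (i, j) * Y $$ (j, i)) = Re (X $$ (i, j) * cnj (Y $$ (i, j)))"
        using herm_index[OF that(2), of j i] by simp
    qed
    also have "\<dots> = (\<Sum>p\<in>{..<N} \<times> {..<N}. Re (X $$ p) * Re (Y $$ p) + Im (X $$ p) * Im (Y $$ p))"
      by (simp add: sum.cartesian_product)
    finally show ?thesis by (simp add: sum.distrib)
  qed
  define q where "q t = rtr (A * A) + 2 * t * rtr (A * B) + t\<^sup>2 * rtr (B * B)" for t :: real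
  have q: "q t \<ge> 0" for t
  proof -
    have "q t = (\<Sum>p\<in>{..<N} \<times> {..<N}. (Re (A $$ p) + t * Re (B $$ p))\<^sup>2 + (Im (A $$ p) + t * Im (B $$ p))\<^sup>2)"
      unfolding q_def e[OF A A] e[OF A B] e[OF B B] sum_distrib_left sum.distrib[symmetric]
      by (intro sum.cong) (auto simp: power2_eq_square algebra_simps)
    then show ?thesis by (simp add: sum_nonneg)
  qed
  show ?thesis
  proof (cases "rtr (B * B) = 0")
    case True
    have "rtr (A * B) = 0"
    proof (rule ccontr)
      assume "rtr (A * B) \<noteq> 0"
      \<comment> \<open>Without its quadratic term \<open>q\<close> is affine with nonzero slope; at
        this \<open>t\<close> it takes the value -1.\<close>
      then have "q (- (rtr (A * A) + 1) / (2 * rtr (A * B))) = -1"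
        unfolding q_def True by (simp add: field_simps)
      with q[of "- (rtr (A * A) + 1) / (2 * rtr (A * B))"] show False by simp
    qed
    then show ?thesis using True by simp
  next
    case False
    then have p: "rtr (B * B) > 0" using rtr_square_nonneg[OF B] by simp
    \<comment> \<open>Evaluate \<open>q\<close> at its minimizer.\<close>
    have "q (- rtr (A * B) / rtr (B * B)) = rtr (A * A) - (rtr (A * B))\<^sup>2 / rtr (B * B)"
      unfolding q_def using p by (simp add: power2_eq_square field_simps)
    then have "(rtr (A * B))\<^sup>2 / rtr (B * B) \<le> rtr (A * A)"
      using q[of "- rtr (A * B) / rtr (B * B)"] by linarith
    with p show ?thesis by (simp add: pos_divide_le_eq)
  qed
qed

section \<open>Diagonalization of Hermitian matrices\<close>

definition unitary :: "nat \<Rightarrow> complex mat \<Rightarrow> bool" where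
  "unitary N U \<longleftrightarrow> U \<in> carrier_mat N N \<and> mat_adjoint U * U = 1\<^sub>m N \<and> U * mat_adjoint U = 1\<^sub>m N"

lemma unitaryI:
  assumes "U \<in> carrier_mat N N" "mat_adjoint U * U = 1\<^sub>m N"
  shows "unitary N U"
  using assms mat_mult_left_right_inverse[of "mat_adjoint U" N U] unfolding unitary_def by auto

lemma unitary_carrier: "unitary N U \<Longrightarrow> U \<in> carrier_mat N N"
  unfolding unitary_def by auto

lemma adjoint_mult_index:
  assumes "U \<in> carrier_mat m n" "A \<in> carrier_mat m k" "i < n" "j < k"
  shows "(mat_adjoint U * A) $$ (i, j) = col A j \<bullet>c col U i"
  using assms by (auto simp: scalar_prod_def intro!: sum.cong)

lemma unitary_with_first_column:
  fixes v :: "complex vec"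
  assumes v: "v \<in> carrier_vec N" and v1: "v \<bullet>c v = 1" and N: "N > 0"
  shows "\<exists>W. unitary N W \<and> col W 0 = v"
proof -
  interpret cof_vec_space N "TYPE(complex)" .
  have v0: "v \<noteq> 0\<^sub>v N" using v1 by auto
  let ?b = "basis_completion v"
  note b = basis_completion[OF v v0]
  define us where "us = gram_schmidt N ?b"
  note g = gram_schmidt_result[OF b(2,4,5) us_def]
  obtain ts where ts: "?b = v # ts"
    using b(6,7) N by (cases ?b) auto
  have hd: "hd us = v" unfolding us_def ts by (rule gram_schmidt_hd[OF v])
  have len: "length us = N" using g(4) b(6) by simp
  have us: "us ! i \<in> carrier_vec N" if "i < N" for i
    using g(3) len that by (metis nth_mem subsetD)
  have orth: "us ! i \<bullet>c us ! j = 0 \<longleftrightarrow> i \<noteq> j" if "i < N" "j < N" for i j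
    using corthogonalD[OF g(2)] that len by simp
  \<comment> \<open>\<open>gram_schmidt\<close> orthogonalizes without normalizing, so
    \<open>c\<close> rescales to unit length; at the unit vector \<open>v\<close> it is 1.\<close>
  define c where "c u = complex_of_real (1 / sqrt (Re (u \<bullet>c u)))" for u
  have cnj_c: "cnj (c u) = c u" for u unfolding c_def by simp
  define W where "W = mat N N (\<lambda>(i, j). c (us ! j) * us ! j $ i)"
  have W: "W \<in> carrier_mat N N" unfolding W_def by simp
  have "(mat_adjoint W * W) $$ (i, j) = (1\<^sub>m N) $$ (i, j)" if ij: "i < N" "j < N" for i j
  proof -
    have "(mat_adjoint W * W) $$ (i, j) = c (us ! i) * c (us ! j) * (us ! j \<bullet>c us ! i)"
      using ij us[OF ij(1)] us[OF ij(2)] W cnj_c unfolding W_def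
      by (auto simp: scalar_prod_def sum_distrib_left algebra_simps intro!: sum.cong)
    also have "\<dots> = (1\<^sub>m N) $$ (i, j)"
    proof (cases "i = j")
      case True
      have ge: "us ! i \<bullet>c us ! i \<ge> 0" by (rule conjugate_square_ge_0_vec)
      then have re: "us ! i \<bullet>c us ! i = of_real (Re (us ! i \<bullet>c us ! i))"
        by (simp add: complex_eq_iff less_eq_complex_def)
      have "Re (us ! i \<bullet>c us ! i) > 0"
        using orth[OF ij(1) ij(1)] ge re
        by (metis less_eq_complex_def less_eq_real_def of_real_0 zero_complex.simps(1))
      then have "c (us ! i) * c (us ! i) * of_real (Re (us ! i \<bullet>c us ! i)) = 1"
        unfolding c_def of_real_mult[symmetric] by (simp del: of_real_mult of_real_divide)
      then show ?thesis using True re ij by simp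
    next
      case False
      then show ?thesis using orth[OF ij(2,1)] ij by simp
    qed
    finally show ?thesis .
  qed
  then have "mat_adjoint W * W = 1\<^sub>m N" using W by (intro eq_matI) auto
  moreover have "col W 0 = v"
  proof -
    have "us ! 0 = v" using hd len N by (simp add: hd_conv_nth[symmetric] length_greater_0_conv[symmetric] del: length_greater_0_conv)
    then show ?thesis using v v1 N unfolding W_def c_def by (intro eq_vecI) auto
  qed
  ultimately show ?thesis using unitaryI[OF W] by auto
qed

definition diag_of :: "nat \<Rightarrow> (nat \<Rightarrow> real) \<Rightarrow> complex mat" where
  "diag_of N d = mat N N (\<lambda>(i, j). if i = j then complex_of_real (d i) else 0)"

lemma diag_of_carrier [simp]: "diag_of N d \<in> carrier_mat N N"
  unfolding diag_of_def by simp

lemma diag_of_mult_left: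
  assumes "A \<in> carrier_mat N M" "i < N" "j < M"
  shows "(diag_of N d * A) $$ (i, j) = d i * A $$ (i, j)"
proof -
  have "(diag_of N d * A) $$ (i, j) = (\<Sum>k<N. diag_of N d $$ (i, k) * A $$ (k, j))"
    using assms by (simp add: scalar_prod_def atLeast0LessThan diag_of_def)
  also have "\<dots> = (\<Sum>k<N. if k = i then d i * A $$ (i, j) else 0)"
    using assms by (intro sum.cong) (auto simp: diag_of_def)
  finally have "(diag_of N d * A) $$ (i, j) = (\<Sum>k<N. if k = i then d i * A $$ (i, j) else 0)" .
  then show ?thesis using assms by simp
qed

lemma diag_of_mult_right:
  assumes "A \<in> carrier_mat M N" "i < M" "j < N"
  shows "(A * diag_of N d) $$ (i, j) = A $$ (i, j) * d j"
proof -
  have "(A * diag_of N d) $$ (i, j) = (\<Sum>k<N. A $$ (i, k) * diag_of N d $$ (k, j))"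
    using assms by (simp add: scalar_prod_def atLeast0LessThan diag_of_def)
  also have "\<dots> = (\<Sum>k<N. if k = j then A $$ (i, j) * d j else 0)"
    using assms by (intro sum.cong) (auto simp: diag_of_def)
  finally have "(A * diag_of N d) $$ (i, j) = (\<Sum>k<N. if k = j then A $$ (i, j) * d j else 0)" .
  then show ?thesis using assms by simp
qed

lemma complex_unit_eigenvector:
  fixes A :: "complex mat"
  assumes A: "A \<in> carrier_mat N N" and N: "N > 0"
  shows "\<exists>e v. v \<in> carrier_vec N \<and> v \<bullet>c v = 1 \<and> A *\<^sub>v v = e \<cdot>\<^sub>v v"
proof -
  obtain e where "eigenvalue A e" using spectrum_non_empty[OF A] N unfolding spectrum_def by auto
  then obtain v where v: "v \<in> carrier_vec N" "v \<noteq> 0\<^sub>v N" "A *\<^sub>v v = e \<cdot>\<^sub>v v"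
    using A unfolding eigenvalue_def eigenvector_def by auto
  define r where "r = Re (v \<bullet>c v)"
  have ge: "v \<bullet>c v \<ge> 0" by (rule conjugate_square_ge_0_vec)
  then have re: "v \<bullet>c v = of_real r"
    unfolding r_def by (simp add: complex_eq_iff less_eq_complex_def)
  have "v \<bullet>c v \<noteq> 0" using v by simp
  with re ge have r: "r > 0" by (auto simp: less_eq_complex_def less_le)
  let ?c = "complex_of_real (1 / sqrt r)"
  let ?w = "?c \<cdot>\<^sub>v v"
  have cc: "?c * ?c * of_real r = 1"
    unfolding of_real_mult[symmetric] using r by (simp del: of_real_mult of_real_divide)
  have "?w \<bullet>c ?w = ?c * ?c * (v \<bullet>c v)"
    using v by (simp add: conjugate_smult_vec)
  then have "?w \<bullet>c ?w = 1" using cc re by simp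
  moreover have "A *\<^sub>v ?w = e \<cdot>\<^sub>v ?w"
    using v A by (simp add: mult_mat_vec smult_smult_assoc mult.commute)
  ultimately show ?thesis using v(1) by (intro exI[of _ e] exI[of _ ?w]) simp
qed

text \<open>Deflation: put a unit eigenvector into the first column of a unitary \<open>W\<close>.
  Conjugation by \<open>W\<close> clears the first column off the diagonal, hermiticity clears the
  first row as well, and the remaining block is Hermitian of size \<open>N\<close>.\<close>

theorem hermitian_diagonalization:
  assumes "herm N A"
  shows "\<exists>U d. unitary N U \<and> A = U * diag_of N d * mat_adjoint U"
  using assms
proof (induct N arbitrary: A)
  case 0
  have "A = 1\<^sub>m 0 * diag_of 0 (\<lambda>_. 0) * mat_adjoint (1\<^sub>m 0)"
    using herm_carrier[OF 0] by (intro eq_matI) auto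
  moreover have "unitary 0 (1\<^sub>m 0)"
    unfolding unitary_def by (auto intro!: eq_matI)
  ultimately show ?case by blast
next
  case (Suc N)
  note A = herm_carrier[OF Suc(2)]
  obtain e v where v: "v \<in> carrier_vec (Suc N)" "v \<bullet>c v = 1" and ev: "A *\<^sub>v v = e \<cdot>\<^sub>v v"
    using complex_unit_eigenvector[OF A] by auto
  obtain W where W: "unitary (Suc N) W" and W0: "col W 0 = v"
    using unitary_with_first_column[OF v] by auto
  note Wc = unitary_carrier[OF W]
  have Wa: "mat_adjoint W \<in> carrier_mat (Suc N) (Suc N)" using Wc by simp
  define B where "B = mat_adjoint W * A * W"
  have hB: "herm (Suc N) B" unfolding B_def by (rule herm_conj[OF Suc(2) Wc])
  note B = herm_carrier[OF hB]
  have B_alt: "B = mat_adjoint W * (A * W)"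
    unfolding B_def by (rule assoc_mult_mat[OF Wa A Wc])
  have B0: "B $$ (i, 0) = (if i = 0 then e else 0)" if i: "i < Suc N" for i
  proof -
    have "B $$ (i, 0) = col (A * W) 0 \<bullet>c col W i"
      unfolding B_alt using Wc A i by (intro adjoint_mult_index[of _ "Suc N"]) auto
    also have "col (A * W) 0 = e \<cdot>\<^sub>v v"
      using col_mult2[OF A Wc] W0 ev by simp
    also have "(e \<cdot>\<^sub>v v) \<bullet>c col W i = e * (v \<bullet>c col W i)"
      using v Wc i by (intro smult_scalar_prod_distrib carrier_vec_conjugate col_carrier_vec) auto
    also have "v \<bullet>c col W i = (mat_adjoint W * W) $$ (i, 0)"
      unfolding W0[symmetric] using Wc i by (intro adjoint_mult_index[symmetric]) auto
    also have "\<dots> = (if i = 0 then 1 else 0)"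
      using W i unfolding unitary_def by simp
    finally show ?thesis by simp
  qed
  have B0': "B $$ (0, i) = (if i = 0 then e else 0)" if i: "i < Suc N" for i
    using herm_index[OF hB, of 0 i] B0[OF i] herm_diag[OF hB, of 0] B0[of 0] i
    by (auto simp: complex_eq_iff)
  have e: "e = of_real (Re e)"
    using herm_diag[OF hB, of 0] B0[of 0] by (simp add: complex_eq_iff)
  define B' where "B' = mat N N (\<lambda>(i, j). B $$ (Suc i, Suc j))"
  have "herm N B'"
    unfolding herm_def
  proof
    show "mat_adjoint B' = B'"
    proof (rule eq_matI)
      fix i j assume "i < dim_row B'" "j < dim_col B'"
      then have "i < N" "j < N" by (simp_all add: B'_def)
      then show "mat_adjoint B' $$ (i, j) = B' $$ (i, j)"
        using herm_index[OF hB, of "Suc i" "Suc j"] by (simp add: B'_def)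
    qed (simp_all add: B'_def)
  qed (simp add: B'_def)
  then obtain U' d where U': "unitary N U'" and B'd: "B' = U' * diag_of N d * mat_adjoint U'"
    using Suc(1) by blast
  note U'c = unitary_carrier[OF U']
  \<comment> \<open>The new eigenvalue takes index 0 and the old ones move up by one.\<close>
  define d' where "d' i = (if i = 0 then Re e else d (i - 1))" for i
  let ?o = "1\<^sub>m 1 :: complex mat" and ?r = "0\<^sub>m 1 N :: complex mat" and ?c = "0\<^sub>m N 1 :: complex mat"
  define V where "V = four_block_mat ?o ?r ?c U'"
  have V: "V \<in> carrier_mat (Suc N) (Suc N)" unfolding V_def using four_block_carrier_mat[of ?o 1 1 U' N N] U'c by simp
  have Va: "mat_adjoint V = four_block_mat ?o ?r ?c (mat_adjoint U')"
    unfolding V_def using U'c by (intro eq_matI) (auto)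
  have "mat_adjoint V * V = four_block_mat ?o ?r ?c (1\<^sub>m N)"
    using U' U'c unfolding Va unfolding V_def unitary_def
    by (subst mult_four_block_mat[of _ 1 1 _ N _ N _ _ 1 _ N]) (auto intro!: cong_four_block_mat)
  then have "mat_adjoint V * V = 1\<^sub>m (Suc N)" using four_block_one_mat[of 1 N] by simp
  have D': "diag_of (Suc N) d' = four_block_mat (mat 1 1 (\<lambda>_. e)) ?r ?c (diag_of N d)"
    by (intro eq_matI) (auto simp: diag_of_def d'_def e[symmetric])
  have "B = four_block_mat (mat 1 1 (\<lambda>_. e)) ?r ?c B'"
    using B B0 B0' by (intro eq_matI) (auto simp: B'_def)
  also have "\<dots> = V * diag_of (Suc N) d' * mat_adjoint V"
  proof -
    have z: "?r * diag_of N d = ?r" "?r * mat_adjoint U' = ?r" "U' * diag_of N d * ?c = ?c"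
      using U'c by (auto intro!: left_mult_zero_mat right_mult_zero_mat mult_carrier_mat[of _ N N])
    have "V * diag_of (Suc N) d' = four_block_mat (mat 1 1 (\<lambda>_. e)) ?r ?c (U' * diag_of N d)"
      unfolding D' V_def using U'c z
      by (subst mult_four_block_mat[of _ 1 1 _ N _ N _ _ 1 _ N]) (auto intro!: cong_four_block_mat)
    moreover have "\<dots> * mat_adjoint V = four_block_mat (mat 1 1 (\<lambda>_. e)) ?r ?c B'"
      unfolding Va B'd using U'c z mult_carrier_mat[OF U'c diag_of_carrier[of N d]]
      by (subst mult_four_block_mat[of _ 1 1 _ N _ N _ _ 1 _ N]) (auto intro!: cong_four_block_mat)
    ultimately show ?thesis by simp
  qed
  finally have BV: "B = V * diag_of (Suc N) d' * mat_adjoint V" .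
  have "A = W * B * mat_adjoint W"
  proof -
    have "W * B * mat_adjoint W = (W * mat_adjoint W) * A * (W * mat_adjoint W)"
      unfolding B_def using Wc Wa A
      by (simp add: assoc_mult_mat[of _ "Suc N" "Suc N" _ "Suc N" _ "Suc N"]
          mult_carrier_mat[of _ "Suc N" "Suc N" _ "Suc N"])
    then show ?thesis using W A unfolding unitary_def by simp
  qed
  also have "\<dots> = (W * V) * diag_of (Suc N) d' * mat_adjoint (W * V)"
    unfolding BV using Wc Wa V
    by (simp add: mat_adjoint_mult[OF Wc V] assoc_mult_mat[of _ "Suc N" "Suc N" _ "Suc N" _ "Suc N"]
          mult_carrier_mat[of _ "Suc N" "Suc N" _ "Suc N"])
  finally have "A = (W * V) * diag_of (Suc N) d' * mat_adjoint (W * V)" .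
  moreover have "unitary (Suc N) (W * V)"
  proof (rule unitaryI)
    have "mat_adjoint (W * V) * (W * V) = mat_adjoint V * ((mat_adjoint W * W) * V)"
      using Wc Wa V
      by (simp add: mat_adjoint_mult[OF Wc V] assoc_mult_mat[of _ "Suc N" "Suc N" _ "Suc N" _ "Suc N"]
          mult_carrier_mat[of _ "Suc N" "Suc N" _ "Suc N"])
    then show "mat_adjoint (W * V) * (W * V) = 1\<^sub>m (Suc N)"
      using W V \<open>mat_adjoint V * V = 1\<^sub>m (Suc N)\<close> unfolding unitary_def by simp
  qed (use Wc V in simp)
  ultimately show ?case by blast
qed

section \<open>Absolute value and trace norm\<close>

lemma adjoint_scalar_prod:
  fixes M :: "complex mat"
  assumes M: "M \<in> carrier_mat m n" and w: "w \<in> carrier_vec m" and v: "v \<in> carrier_vec n"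
  shows "(mat_adjoint M *\<^sub>v w) \<bullet>c v = w \<bullet>c (M *\<^sub>v v)"
proof -
  have "(mat_adjoint M *\<^sub>v w) \<bullet>c v = (\<Sum>j<n. \<Sum>i<m. cnj (M $$ (i, j)) * w $ i * cnj (v $ j))"
    using M w v by (auto simp: scalar_prod_def atLeast0LessThan sum_distrib_right intro!: sum.cong)
  also have "\<dots> = (\<Sum>i<m. \<Sum>j<n. cnj (M $$ (i, j)) * w $ i * cnj (v $ j))"
    by (rule sum.swap)
  also have "\<dots> = w \<bullet>c (M *\<^sub>v v)"
    using M w v by (auto simp: scalar_prod_def atLeast0LessThan sum_distrib_left algebra_simps intro!: sum.cong)
  finally show ?thesis .
qed

lemma diag_of_dim [simp]: "dim_row (diag_of N d) = N" "dim_col (diag_of N d) = N"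
  unfolding diag_of_def by simp_all

lemma diag_of_mult: "diag_of N d * diag_of N e = diag_of N (\<lambda>i. d i * e i)"
proof (rule eq_matI)
  fix i j assume "i < dim_row (diag_of N (\<lambda>i. d i * e i))" "j < dim_col (diag_of N (\<lambda>i. d i * e i))"
  then have "i < N" "j < N" by (simp_all add: diag_of_def)
  then show "(diag_of N d * diag_of N e) $$ (i, j) = diag_of N (\<lambda>i. d i * e i) $$ (i, j)"
    by (subst diag_of_mult_left[of _ N N]) (simp_all add: diag_of_def)
qed (simp_all add: diag_of_def)

lemma herm_diag_of [simp]: "herm N (diag_of N d)"
  unfolding herm_def by (auto simp: diag_of_def intro!: eq_matI)

text \<open>In eigenbases of \<open>B\<close> and \<open>C\<close>, the transition matrix \<open>M\<close> satisfies \<open>d\<^sub>i\<^sup>2 M\<^sub>i\<^sub>j = M\<^sub>i\<^sub>j e\<^sub>j\<^sup>2\<close>, and the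
  squares can be dropped because the eigenvalues are nonnegative.\<close>

lemma psd_square_root_unique:
  assumes B: "psd_mat N B" and C: "psd_mat N C" and BC: "B * B = C * C"
  shows "B = C"
proof -
  have h: "herm N B" "herm N C" using B C unfolding psd_mat_def herm_def by auto
  obtain U d where U: "unitary N U" and Bd: "B = U * diag_of N d * mat_adjoint U"
    using hermitian_diagonalization[OF h(1)] by auto
  obtain V e where V: "unitary N V" and Ce: "C = V * diag_of N e * mat_adjoint V"
    using hermitian_diagonalization[OF h(2)] by auto
  note Uc = unitary_carrier[OF U] and Vc = unitary_carrier[OF V]
  note U1 = U[unfolded unitary_def] and V1 = V[unfolded unitary_def]
  note sq [simp] = mult_carrier_mat[of _ N N _ N] and assoc = assoc_mult_mat[of _ N N _ N _ N]
  \<comment> \<open>Each eigenvalue is the value of the quadratic form of \<open>X\<close> at the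
    corresponding column of \<open>W\<close>.\<close>
  have ev: "d i \<ge> 0" if "psd_mat N X" "unitary N W" "X = W * diag_of N d * mat_adjoint W" "i < N" for X W d i
  proof -
    note Wc = unitary_carrier[OF that(2)]
    have X: "X \<in> carrier_mat N N" using that(1) unfolding psd_mat_def by simp
    have "mat_adjoint W * (X * W) = (mat_adjoint W * W) * diag_of N d * (mat_adjoint W * W)"
      unfolding that(3) using Wc by (simp add: assoc)
    then have "diag_of N d = mat_adjoint W * (X * W)"
      using that(2) unfolding unitary_def by simp
    moreover have "diag_of N d $$ (i, i) = complex_of_real (d i)"
      using that(4) by (simp add: diag_of_def)
    ultimately have "complex_of_real (d i) = (mat_adjoint W * (X * W)) $$ (i, i)"
      by simp
    also have "\<dots> = col (X * W) i \<bullet>c col W i"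
      using Wc X that(4) by (intro adjoint_mult_index) auto
    also have "col (X * W) i = X *\<^sub>v col W i"
      by (rule col_mult2[OF X Wc that(4)])
    finally have "d i = Re ((X *\<^sub>v col W i) \<bullet>c col W i)" by (metis Re_complex_of_real)
    then show ?thesis using that(1,4) Wc unfolding psd_mat_def by auto
  qed
  define M where "M = mat_adjoint U * V"
  have M: "M \<in> carrier_mat N N" unfolding M_def using Uc Vc by simp
  have "diag_of N d * diag_of N d * M = mat_adjoint U * (B * B) * V"
  proof -
    have "mat_adjoint U * (B * B) * V = (mat_adjoint U * U) * diag_of N d * (mat_adjoint U * U) * diag_of N d * (mat_adjoint U * V)"
      unfolding Bd using Uc Vc by (simp add: assoc)
    then show ?thesis using U1 M unfolding M_def by (simp add: assoc)
  qed
  moreover have "M * (diag_of N e * diag_of N e) = mat_adjoint U * (C * C) * V"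
  proof -
    have "mat_adjoint U * (C * C) * V = (mat_adjoint U * V) * diag_of N e * (mat_adjoint V * V) * diag_of N e * (mat_adjoint V * V)"
      unfolding Ce using Uc Vc by (simp add: assoc)
    then show ?thesis using V1 M Uc unfolding M_def by (simp add: assoc)
  qed
  ultimately have "diag_of N (\<lambda>i. d i * d i) * M = M * diag_of N (\<lambda>i. e i * e i)"
    using BC by (simp add: diag_of_mult)
  then have eqm: "(diag_of N (\<lambda>i. d i * d i) * M) $$ p = (M * diag_of N (\<lambda>i. e i * e i)) $$ p" for p
    by simp
  have eq: "complex_of_real (d i * d i) * M $$ (i, j) = M $$ (i, j) * complex_of_real (e j * e j)"
    if "i < N" "j < N" for i j
    using eqm[of "(i, j)"] unfolding diag_of_mult_left[OF M that] diag_of_mult_right[OF M that] .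
  have "diag_of N d * M = M * diag_of N e"
  proof (rule eq_matI)
    fix i j assume "i < dim_row (M * diag_of N e)" "j < dim_col (M * diag_of N e)"
    then have ij: "i < N" "j < N" using M by (simp_all add: diag_of_def)
    have "d i = e j" if "M $$ (i, j) \<noteq> 0"
    proof -
      have "complex_of_real (d i * d i) = complex_of_real (e j * e j)"
        using eq[OF ij] that by (metis mult.commute mult_cancel_left)
      then have "d i * d i = e j * e j" by (simp only: of_real_eq_iff)
      then show ?thesis using ev[OF B U Bd ij(1)] ev[OF C V Ce ij(2)]
        by (metis abs_of_nonneg real_sqrt_mult_self real_sqrt_abs2)
    qed
    then show "(diag_of N d * M) $$ (i, j) = (M * diag_of N e) $$ (i, j)"
      unfolding diag_of_mult_left[OF M ij] diag_of_mult_right[OF M ij] by auto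
  qed (use M in \<open>simp_all add: diag_of_def\<close>)
  then have "U * (diag_of N d * M) * mat_adjoint V = U * (M * diag_of N e) * mat_adjoint V" by simp
  moreover have "U * (diag_of N d * M) * mat_adjoint V = (U * diag_of N d * mat_adjoint U) * (V * mat_adjoint V)"
    unfolding M_def using Uc Vc by (simp add: assoc)
  moreover have "U * (M * diag_of N e) * mat_adjoint V = (U * mat_adjoint U) * (V * diag_of N e * mat_adjoint V)"
    unfolding M_def using Uc Vc by (simp add: assoc)
  ultimately show ?thesis
    unfolding Bd Ce using U1 V1 Uc Vc by simp
qed

text \<open>\<open>mat_abs\<close> is a definite description, so it suffices to exhibit one positive
  semidefinite square root; \<open>psd_square_root_unique\<close> does the rest.\<close>

lemma mat_abs_hermitian:
  assumes U: "unitary N U" and A: "A = U * diag_of N d * mat_adjoint U"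
  shows "mat_abs A = U * diag_of N (\<lambda>i. \<bar>d i\<bar>) * mat_adjoint U"
proof -
  note Uc = unitary_carrier[OF U] and U1 = U[unfolded unitary_def]
  note sq [simp] = mult_carrier_mat[of _ N N _ N] and assoc = assoc_mult_mat[of _ N N _ N _ N]
  have h: "herm N (U * diag_of N f * mat_adjoint U)" for f
    using herm_conj[of N "diag_of N f" "mat_adjoint U" N] Uc by simp
  let ?B = "U * diag_of N (\<lambda>i. \<bar>d i\<bar>) * mat_adjoint U"
  have s: "U * diag_of N f * mat_adjoint U * (U * diag_of N g * mat_adjoint U) =
      U * diag_of N (\<lambda>i. f i * g i) * mat_adjoint U" for f g
  proof -
    have "U * diag_of N f * mat_adjoint U * (U * diag_of N g * mat_adjoint U) =
      U * (diag_of N f * (mat_adjoint U * U) * diag_of N g) * mat_adjoint U"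
      using Uc by (simp add: assoc)
    then show ?thesis using U1 by (simp add: diag_of_mult)
  qed
  have "psd_mat N ?B"
    unfolding psd_mat_def
  proof (intro conjI ballI)
    fix v :: "complex vec" assume v: "v \<in> carrier_vec N"
    \<comment> \<open>\<open>?R\<close> is a Hermitian square root of \<open>?B\<close>, so the
      quadratic form of \<open>?B\<close> at \<open>v\<close> is the squared length of
      \<open>?R *\<^sub>v v\<close>.\<close>
    let ?R = "U * diag_of N (\<lambda>i. sqrt \<bar>d i\<bar>) * mat_adjoint U"
    have R: "?R \<in> carrier_mat N N" using Uc by simp
    have "?B *\<^sub>v v = mat_adjoint ?R *\<^sub>v (?R *\<^sub>v v)"
      unfolding herm_adjoint[OF h] using s[of "\<lambda>i. sqrt \<bar>d i\<bar>" "\<lambda>i. sqrt \<bar>d i\<bar>"] R v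
      by (simp add: assoc_mult_mat_vec[OF R R v, symmetric])
    then have "(?B *\<^sub>v v) \<bullet>c v = (?R *\<^sub>v v) \<bullet>c (?R *\<^sub>v v)"
      using adjoint_scalar_prod[OF R mult_mat_vec_carrier[OF R v] v] by simp
    moreover have "(?R *\<^sub>v v) \<bullet>c (?R *\<^sub>v v) \<ge> 0" by (rule conjugate_square_ge_0_vec)
    ultimately show "0 \<le> Re ((?B *\<^sub>v v) \<bullet>c v)"
      by (simp add: less_eq_complex_def)
  qed (rule herm_carrier[OF h] herm_adjoint[OF h])+
  moreover have "?B * ?B = mat_adjoint A * A"
    unfolding A herm_adjoint[OF h] s by simp
  moreover have "dim_row A = N" unfolding A using Uc by simp
  ultimately show ?thesis
    unfolding mat_abs_def
    by (metis (mono_tags, lifting) psd_square_root_unique the_equality)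
qed

text \<open>By cyclicity the trace can be taken in the eigenbasis of the second factor, where only
  the diagonal of \<open>C\<close> contributes. Both trace dualities below become scalar
  inequalities this way.\<close>

lemma rtr_mult_diagonalized:
  assumes U: "unitary N U" and C: "C \<in> carrier_mat N N"
  shows "rtr (C * (U * diag_of N d * mat_adjoint U)) = (\<Sum>i<N. Re ((mat_adjoint U * C * U) $$ (i, i)) * d i)"
proof -
  note Uc = unitary_carrier[OF U]
  note sq [simp] = mult_carrier_mat[of _ N N _ N] and assoc = assoc_mult_mat[of _ N N _ N _ N]
  have "rtr (C * (U * diag_of N d * mat_adjoint U)) = rtr (C * (U * diag_of N d) * mat_adjoint U)"
    using Uc C by (simp add: assoc)
  also have "\<dots> = rtr (mat_adjoint U * (C * (U * diag_of N d)))"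
    using Uc C by (intro rtr_comm[of _ N N]) auto
  also have "\<dots> = rtr (mat_adjoint U * C * U * diag_of N d)"
    using Uc C by (simp add: assoc)
  also have "\<dots> = (\<Sum>i<N. Re ((mat_adjoint U * C * U * diag_of N d) $$ (i, i)))"
    unfolding rtr_def mat_trace_def Re_sum using Uc C by simp
  also have "\<dots> = (\<Sum>i<N. Re ((mat_adjoint U * C * U) $$ (i, i)) * d i)"
    using Uc C by (intro sum.cong refl) (subst diag_of_mult_right[of _ N N]; simp)
  finally show ?thesis .
qed

text \<open>The diagonal entry of \<open>M * M\<close> is the squared length of row \<open>i\<close>
  of \<open>M\<close>, and the diagonal entry of \<open>M\<close> is one of the coordinates of that
  row.\<close>

lemma herm_diag_square:
  assumes M: "herm N M" and i: "i < N"
  shows "(Re (M $$ (i, i)))\<^sup>2 \<le> Re ((M * M) $$ (i, i))"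
proof -
  have "Re ((M * M) $$ (i, i)) = (\<Sum>j<N. Re (M $$ (i, j) * M $$ (j, i)))"
    using herm_carrier[OF M] i by (auto simp: scalar_prod_def atLeast0LessThan intro!: sum.cong)
  also have "\<dots> = (\<Sum>j<N. (cmod (M $$ (i, j)))\<^sup>2)"
  proof (intro sum.cong refl)
    fix j assume "j \<in> {..<N}"
    then show "Re (M $$ (i, j) * M $$ (j, i)) = (cmod (M $$ (i, j)))\<^sup>2"
      using herm_index[OF M, of j i] i cmod_power2[of "M $$ (i, j)"] by (simp add: power2_eq_square)
  qed
  also have "\<dots> \<ge> (cmod (M $$ (i, i)))\<^sup>2"
    using i by (intro member_le_sum) auto
  moreover have "(Re (M $$ (i, i)))\<^sup>2 \<le> (cmod (M $$ (i, i)))\<^sup>2" by (simp add: cmod_power2)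
  ultimately show ?thesis by linarith
qed

text \<open>For idempotent \<open>P\<close> the preceding bound says that the square of a diagonal
  entry is at most the entry itself.\<close>

lemma herm_idempotent_diag:
  assumes P: "herm N P" "P * P = P" and i: "i < N"
  shows "0 \<le> Re (P $$ (i, i)) \<and> Re (P $$ (i, i)) \<le> 1"
proof -
  have "(Re (P $$ (i, i)))\<^sup>2 \<le> Re (P $$ (i, i))"
    using herm_diag_square[OF P(1) i] P(2) by simp
  then have "Re (P $$ (i, i)) * (1 - Re (P $$ (i, i))) \<ge> 0"
    by (simp add: power2_eq_square algebra_simps)
  then show ?thesis by (auto simp: zero_le_mult_iff)
qed

lemma unitary_conj_mult:
  assumes U: "unitary N U" and A: "A \<in> carrier_mat N N" and B: "B \<in> carrier_mat N N"
  shows "(mat_adjoint U * A * U) * (mat_adjoint U * B * U) = mat_adjoint U * (A * B) * U"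
proof -
  note Uc = unitary_carrier[OF U]
  note sq [simp] = mult_carrier_mat[of _ N N _ N] and assoc = assoc_mult_mat[of _ N N _ N _ N]
  have "(mat_adjoint U * A * U) * (mat_adjoint U * B * U) = mat_adjoint U * (A * (U * mat_adjoint U) * B) * U"
    using Uc A B by (simp add: assoc)
  then show ?thesis using U A unfolding unitary_def by simp
qed

lemma rtr_unitary_conj:
  assumes U: "unitary N U" and A: "A \<in> carrier_mat N N"
  shows "rtr (mat_adjoint U * A * U) = rtr A"
proof -
  note Uc = unitary_carrier[OF U]
  note sq [simp] = mult_carrier_mat[of _ N N _ N] and assoc = assoc_mult_mat[of _ N N _ N _ N]
  have "rtr (mat_adjoint U * A * U) = rtr (U * (mat_adjoint U * A))"
    using Uc A by (intro rtr_comm[of _ N N]) auto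
  also have "U * (mat_adjoint U * A) = A"
    using U A Uc unfolding unitary_def by (simp add: assoc[symmetric])
  finally show ?thesis .
qed

lemma rtr_mat_abs:
  assumes U: "unitary N U" and A: "A = U * diag_of N d * mat_adjoint U"
  shows "rtr (mat_abs A) = (\<Sum>i<N. \<bar>d i\<bar>)"
proof -
  note Uc = unitary_carrier[OF U]
  have M: "U * diag_of N (\<lambda>i. \<bar>d i\<bar>) * mat_adjoint U \<in> carrier_mat N N"
    using Uc by (simp add: mult_carrier_mat[of _ N N _ N])
  have "rtr (mat_abs A) = rtr (1\<^sub>m N * (U * diag_of N (\<lambda>i. \<bar>d i\<bar>) * mat_adjoint U))"
    unfolding mat_abs_hermitian[OF U A] left_mult_one_mat[OF M] by simp
  also have "\<dots> = (\<Sum>i<N. Re ((mat_adjoint U * 1\<^sub>m N * U) $$ (i, i)) * \<bar>d i\<bar>)"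
    by (rule rtr_mult_diagonalized[OF U]) simp
  also have "mat_adjoint U * 1\<^sub>m N * U = 1\<^sub>m N"
    using U Uc unfolding unitary_def by simp
  finally show ?thesis by simp
qed

lemma trace_norm_nonneg:
  assumes "herm N A"
  shows "0 \<le> rtr (mat_abs A)"
proof -
  obtain U d where "unitary N U" "A = U * diag_of N d * mat_adjoint U"
    using hermitian_diagonalization[OF assms] by auto
  then show ?thesis by (simp add: rtr_mat_abs sum_nonneg)
qed

text \<open>In an eigenbasis of \<open>A\<close> the projection has diagonal entries in [0, 1], so
  the trace is at most the sum of the absolute values of the eigenvalues.\<close>

lemma trace_norm_dual_projection:
  assumes A: "herm N A" and P: "herm N P" and PP: "P * P = P"
  shows "rtr (P * A) \<le> rtr (mat_abs A)"
proof -
  obtain U d where U: "unitary N U" and Ad: "A = U * diag_of N d * mat_adjoint U"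
    using hermitian_diagonalization[OF A] by auto
  define M where "M = mat_adjoint U * P * U"
  have M: "herm N M" unfolding M_def by (rule herm_conj[OF P unitary_carrier[OF U]])
  have "M * M = M"
    unfolding M_def unitary_conj_mult[OF U herm_carrier[OF P] herm_carrier[OF P]] PP ..
  then have c: "0 \<le> Re (M $$ (i, i)) \<and> Re (M $$ (i, i)) \<le> 1" if "i < N" for i
    using herm_idempotent_diag[OF M _ that] by simp
  have "rtr (P * A) = (\<Sum>i<N. Re (M $$ (i, i)) * d i)"
    unfolding Ad M_def by (rule rtr_mult_diagonalized[OF U herm_carrier[OF P]])
  also have "\<dots> \<le> (\<Sum>i<N. \<bar>d i\<bar>)"
  proof (intro sum_mono)
    fix i assume "i \<in> {..<N}"
    then show "Re (M $$ (i, i)) * d i \<le> \<bar>d i\<bar>"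
      using c[of i] mult_left_mono[OF abs_ge_self[of "d i"], of "Re (M $$ (i, i))"]
        mult_right_mono[of "Re (M $$ (i, i))" 1 "\<bar>d i\<bar>"] by simp
  qed
  finally show ?thesis unfolding rtr_mat_abs[OF U Ad] .
qed

text \<open>In normalized norms, this is \<open>\<bar>\<langle>C, A\<rangle>\<bar>\<^sup>2 \<le> \<parallel>A\<parallel>\<^sub>1 \<parallel>A\<parallel>\<^sub>2 \<parallel>C\<parallel>\<^sub>4\<^sup>2\<close>, which replaces the duality between the
  \<open>4\<close>-norm and the \<open>4/3\<close>-norm.\<close>

lemma trace_norm_interpolation:
  assumes A: "herm N A" and C: "herm N C"
  shows "(rtr (C * A)) ^ 4 \<le> (rtr (mat_abs A))\<^sup>2 * rtr (A * A) * rtr (C * C * (C * C))"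
proof -
  obtain U d where U: "unitary N U" and Ad: "A = U * diag_of N d * mat_adjoint U"
    using hermitian_diagonalization[OF A] by auto
  note Ac = herm_carrier[OF A] and Cc = herm_carrier[OF C] and Uc = unitary_carrier[OF U]
  note sq [simp] = mult_carrier_mat[of _ N N _ N]
  define M where "M = mat_adjoint U * C * U"
  have M: "herm N M" unfolding M_def by (rule herm_conj[OF C Uc])
  define c where "c i = Re (M $$ (i, i))" for i
  have CA: "rtr (C * A) = (\<Sum>i<N. c i * d i)"
    unfolding Ad c_def M_def by (rule rtr_mult_diagonalized[OF U Cc])
  have AA: "rtr (A * A) = (\<Sum>i<N. (d i)\<^sup>2)"
  proof -
    have "mat_adjoint U * A * U = (mat_adjoint U * U) * diag_of N d * (mat_adjoint U * U)"
      unfolding Ad using Uc by (simp add: assoc_mult_mat[of _ N N _ N _ N])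
    also have "\<dots> = diag_of N d"
      using U unfolding unitary_def by simp
    finally have "mat_adjoint U * A * U = diag_of N d" .
    then have "rtr (A * A) = (\<Sum>i<N. Re (diag_of N d $$ (i, i)) * d i)"
      using rtr_mult_diagonalized[OF U Ac, of d] unfolding Ad[symmetric] by simp
    also have "\<dots> = (\<Sum>i<N. (d i)\<^sup>2)"
      by (intro sum.cong) (auto simp: diag_of_def power2_eq_square)
    finally show ?thesis .
  qed
  \<comment> \<open>\<open>herm_diag_square\<close>, applied to \<open>M\<close> and then to
    \<open>M * M\<close>, bounds the fourth power of a diagonal entry by the diagonal entry of the
    fourth power; the trace is invariant under conjugation by \<open>U\<close>.\<close>
  have C4: "(\<Sum>i<N. c i ^ 4) \<le> rtr (C * C * (C * C))"
  proof -
    have CC: "C * C \<in> carrier_mat N N" using Cc by simp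
    have e: "M * M * (M * M) = mat_adjoint U * (C * C * (C * C)) * U"
      unfolding M_def unitary_conj_mult[OF U Cc Cc] unitary_conj_mult[OF U CC CC] ..
    have "(\<Sum>i<N. c i ^ 4) \<le> (\<Sum>i<N. Re ((M * M * (M * M)) $$ (i, i)))"
    proof (intro sum_mono)
      fix i assume "i \<in> {..<N}"
      then have i: "i < N" by simp
      have "c i ^ 4 = ((c i)\<^sup>2)\<^sup>2" by simp
      also have "\<dots> \<le> (Re ((M * M) $$ (i, i)))\<^sup>2"
        using herm_diag_square[OF M i] unfolding c_def by (intro power_mono) auto
      also have "\<dots> \<le> Re ((M * M * (M * M)) $$ (i, i))"
        by (rule herm_diag_square[OF herm_square[OF M] i])
      finally show "c i ^ 4 \<le> Re ((M * M * (M * M)) $$ (i, i))" .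
    qed
    also have "\<dots> = rtr (M * M * (M * M))"
      using herm_carrier[OF M] unfolding rtr_def mat_trace_def Re_sum by simp
    also have "\<dots> = rtr (C * C * (C * C))"
      unfolding e using CC by (intro rtr_unitary_conj[OF U]) simp
    finally show ?thesis .
  qed
  \<comment> \<open>\<open>T\<close> is the trace norm of \<open>A\<close>. Cauchy-Schwarz is used
    twice: splitting each \<open>\<bar>d i\<bar>\<close> into two square roots gives the product
    \<open>T * S\<close>, and then \<open>S\<close> is split into the factors
    \<open>\<bar>d i\<bar>\<close> and \<open>(c i)\<^sup>2\<close>.\<close>
  define T S where "T = (\<Sum>i<N. \<bar>d i\<bar>)" and "S = (\<Sum>i<N. \<bar>d i\<bar> * (c i)\<^sup>2)"
  have S0: "S \<ge> 0" and T0: "T \<ge> 0" unfolding S_def T_def by (simp_all add: sum_nonneg)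
  have "(\<Sum>i<N. c i * d i)\<^sup>2 = (\<Sum>i<N. sqrt \<bar>d i\<bar> * (sgn (d i) * sqrt \<bar>d i\<bar> * c i))\<^sup>2"
  proof -
    have "c i * d i = sqrt \<bar>d i\<bar> * (sgn (d i) * sqrt \<bar>d i\<bar> * c i)" for i
    proof -
      have "sqrt \<bar>d i\<bar> * (sgn (d i) * sqrt \<bar>d i\<bar> * c i) = sgn (d i) * (sqrt \<bar>d i\<bar> * sqrt \<bar>d i\<bar>) * c i"
        by (simp only: mult_ac)
      also have "sqrt \<bar>d i\<bar> * sqrt \<bar>d i\<bar> = \<bar>d i\<bar>" by simp
      finally show ?thesis by (metis mult.commute sgn_mult_abs)
    qed
    then show ?thesis by (simp only:)
  qed
  also have "\<dots> \<le> (\<Sum>i<N. (sqrt \<bar>d i\<bar>)\<^sup>2) * (\<Sum>i<N. (sgn (d i) * sqrt \<bar>d i\<bar> * c i)\<^sup>2)"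
    by (rule Cauchy_Schwarz_ineq_sum)
  also have "\<dots> = T * S"
  proof -
    have "(sgn (d i) * sqrt \<bar>d i\<bar> * c i)\<^sup>2 = \<bar>d i\<bar> * (c i)\<^sup>2" for i
      by (simp add: power_mult_distrib sgn_if)
    then show ?thesis unfolding T_def S_def by simp
  qed
  finally have "((\<Sum>i<N. c i * d i)\<^sup>2)\<^sup>2 \<le> (T * S)\<^sup>2"
    by (intro power_mono) auto
  moreover have "S\<^sup>2 \<le> (\<Sum>i<N. (d i)\<^sup>2) * (\<Sum>i<N. c i ^ 4)"
    using Cauchy_Schwarz_ineq_sum[of "\<lambda>i. \<bar>d i\<bar>" "\<lambda>i. (c i)\<^sup>2" "{..<N}"]
    unfolding S_def by simp
  then have "T\<^sup>2 * S\<^sup>2 \<le> T\<^sup>2 * ((\<Sum>i<N. (d i)\<^sup>2) * rtr (C * C * (C * C)))"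
    using mult_left_mono[OF C4, of "\<Sum>i<N. (d i)\<^sup>2"] by (intro mult_left_mono) (auto simp: sum_nonneg)
  ultimately show ?thesis
    unfolding CA AA rtr_mat_abs[OF U Ad] T_def[symmetric] by (simp add: power_mult_distrib mult.assoc)
qed

section \<open>Orthogonal projections\<close>

definition outer :: "complex vec \<Rightarrow> complex mat" where
  "outer u = mat (dim_vec u) (dim_vec u) (\<lambda>(i, j). u $ i * cnj (u $ j))"

lemma outer_carrier: "u \<in> carrier_vec N \<Longrightarrow> outer u \<in> carrier_mat N N"
  unfolding outer_def by auto

lemma herm_outer: "u \<in> carrier_vec N \<Longrightarrow> herm N (outer u)"
  unfolding herm_def outer_def by (auto intro!: eq_matI)

lemma outer_mult_vec:
  assumes "u \<in> carrier_vec N" "v \<in> carrier_vec N"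
  shows "outer u *\<^sub>v v = (v \<bullet>c u) \<cdot>\<^sub>v u"
  using assms unfolding outer_def
  by (intro eq_vecI) (auto simp: scalar_prod_def sum_distrib_left sum_distrib_right intro!: sum.cong)

lemma rtr_outer: "u \<in> carrier_vec N \<Longrightarrow> rtr (outer u) = Re (u \<bullet>c u)"
  unfolding outer_def rtr_def mat_trace_def
  by (auto simp: scalar_prod_def atLeast0LessThan)

lemma mult_outer:
  assumes "A \<in> carrier_mat N N" "u \<in> carrier_vec N" "i < N" "j < N"
  shows "(A * outer u) $$ (i, j) = (A *\<^sub>v u) $ i * cnj (u $ j)"
  using assms unfolding outer_def
  by (auto simp: scalar_prod_def sum_distrib_right intro!: sum.cong)

lemma rtr_projection_le:
  assumes P: "herm N P" "P * P = P"
  shows "rtr P \<le> real N"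
proof -
  have "rtr P = (\<Sum>i<N. Re (P $$ (i, i)))"
    using herm_carrier[OF P(1)] unfolding rtr_def mat_trace_def by simp
  also have "\<dots> \<le> (\<Sum>i<N. 1)"
    using herm_idempotent_diag[OF P] by (intro sum_mono) auto
  finally show ?thesis by simp
qed

lemma mat_eq_by_vec:
  fixes A B :: "complex mat"
  assumes A: "A \<in> carrier_mat m n" and B: "B \<in> carrier_mat m n"
    and eq: "\<And>v. v \<in> carrier_vec n \<Longrightarrow> A *\<^sub>v v = B *\<^sub>v v"
  shows "A = B"
proof (rule eq_matI)
  fix i j assume "i < dim_row B" "j < dim_col B"
  then have ij: "i < m" "j < n" using B by auto
  have "(A *\<^sub>v unit_vec n j) $ i = (B *\<^sub>v unit_vec n j) $ i" using eq[of "unit_vec n j"] by simp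
  then show "A $$ (i, j) = B $$ (i, j)" using A B ij by simp
qed (use A B in auto)

lemma minus_vec_eq_zero:
  fixes v w :: "complex vec"
  assumes v: "v \<in> carrier_vec N" and w: "w \<in> carrier_vec N" and eq: "v - w = 0\<^sub>v N"
  shows "v = w"
proof (rule eq_vecI)
  fix i assume i: "i < dim_vec w"
  have "(v - w) $ i = 0" unfolding eq using i w by simp
  then show "v $ i = w $ i" using i v w by simp
qed (use v w in auto)

text \<open>A projection into \<open>W\<close> that does not fix \<open>W\<close> pointwise can be enlarged by a projection of rank one; this
  raises the trace by one, and the trace is at most \<open>N\<close>.\<close>

lemma orthogonal_projection_exists:
  assumes W: "W \<subseteq> carrier_vec N" and W0: "0\<^sub>v N \<in> W"
    and Wadd: "\<And>v w. v \<in> W \<Longrightarrow> w \<in> W \<Longrightarrow> v + w \<in> W"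
    and Wsmult: "\<And>c v. v \<in> W \<Longrightarrow> c \<cdot>\<^sub>v v \<in> W"
  shows "\<exists>Q. herm N Q \<and> Q * Q = Q \<and>
    (\<forall>v \<in> carrier_vec N. Q *\<^sub>v v \<in> W \<and> (\<forall>w \<in> W. (v - Q *\<^sub>v v) \<bullet>c w = 0))"
proof -
  define good where "good Q \<longleftrightarrow> herm N Q \<and> Q * Q = Q \<and> (\<forall>v \<in> carrier_vec N. Q *\<^sub>v v \<in> W)" for Q
  have extend: "\<exists>Q'. good Q' \<and> rtr Q' = rtr Q + 1"
    if Q: "good Q" and w: "w \<in> W" and ne: "Q *\<^sub>v w \<noteq> w" for Q w
  proof -
    have hQ: "herm N Q" and QQ: "Q * Q = Q" and QW: "\<And>v. v \<in> carrier_vec N \<Longrightarrow> Q *\<^sub>v v \<in> W"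
      using Q unfolding good_def by auto
    note Qc = herm_carrier[OF hQ]
    have wc: "w \<in> carrier_vec N" using w W by auto
    have Qw: "Q *\<^sub>v w \<in> carrier_vec N" using Qc wc by simp
    \<comment> \<open>\<open>u\<close> is the part of \<open>w\<close> that \<open>Q\<close> misses.
      As \<open>Q\<close> annihilates it, the rank-one projection \<open>R\<close> onto its span is
      orthogonal to \<open>Q\<close>.\<close>
    define u where "u = w - Q *\<^sub>v w"
    have u: "u \<in> carrier_vec N" unfolding u_def using Qw wc by simp
    have "u = w + (-1) \<cdot>\<^sub>v (Q *\<^sub>v w)" unfolding u_def using Qw wc by (intro eq_vecI) auto
    then have uW: "u \<in> W" using Wadd[OF w Wsmult[OF QW[OF wc], of "-1"]] by simp
    have "Q *\<^sub>v u = Q *\<^sub>v w - Q *\<^sub>v (Q *\<^sub>v w)"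
      unfolding u_def by (rule mult_minus_distrib_mat_vec[OF Qc wc Qw])
    also have "Q *\<^sub>v (Q *\<^sub>v w) = Q *\<^sub>v w"
      using assoc_mult_mat_vec[OF Qc Qc wc] QQ by simp
    finally have Qu: "Q *\<^sub>v u = 0\<^sub>v N" using Qw by simp
    have "u \<noteq> 0\<^sub>v N"
    proof
      assume "u = 0\<^sub>v N"
      then have "Q *\<^sub>v w = w" using minus_vec_eq_zero[OF wc Qw] unfolding u_def by simp
      with ne show False ..
    qed
    then have "u \<bullet>c u > 0" using u by (simp add: conjugate_square_greater_0_vec)
    define c where "c = Re (u \<bullet>c u)"
    have c: "c > 0" and uu: "u \<bullet>c u = of_real c"
      using \<open>u \<bullet>c u > 0\<close> unfolding c_def by (auto simp: less_complex_def complex_eq_iff)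
    define R where "R = complex_of_real (1 / c) \<cdot>\<^sub>m outer u"
    have hR: "herm N R" unfolding R_def by (intro herm_smult herm_outer u)
    note Rc = herm_carrier[OF hR]
    note Oc = outer_carrier[OF u]
    have QO: "Q * outer u = 0\<^sub>m N N"
      using mult_outer[OF Qc u] Qu Qc Oc by (intro eq_matI) auto
    have QR: "Q * R = 0\<^sub>m N N"
      unfolding R_def mult_smult_distrib[OF Qc Oc] QO by auto
    have "R * Q = mat_adjoint (Q * R)"
      using mat_adjoint_mult[OF Qc Rc] hQ hR by simp
    then have RQ: "R * Q = 0\<^sub>m N N" unfolding QR by (auto intro!: eq_matI)
    have RR: "R * R = R"
    proof -
      have "outer u * outer u = of_real c \<cdot>\<^sub>m outer u"
      proof (rule eq_matI)
        fix i j assume "i < dim_row (of_real c \<cdot>\<^sub>m outer u)" "j < dim_col (of_real c \<cdot>\<^sub>m outer u)"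
        then have ij: "i < N" "j < N" using Oc by auto
        then show "(outer u * outer u) $$ (i, j) = (of_real c \<cdot>\<^sub>m outer u) $$ (i, j)"
          unfolding mult_outer[OF Oc u ij] outer_mult_vec[OF u u] uu using u by (simp add: outer_def)
      qed (use Oc in auto)
      then have "R * R = complex_of_real (1 / c) \<cdot>\<^sub>m (complex_of_real (1 / c) \<cdot>\<^sub>m (of_real c \<cdot>\<^sub>m outer u))"
        unfolding R_def using Oc by (simp add: mult_smult_distrib[of _ N N] mult_smult_assoc_mat[of _ N N])
      also have "\<dots> = R" unfolding R_def using c Oc by (intro eq_matI) auto
      finally show ?thesis .
    qed
    define Q' where "Q' = Q + R"
    have Q': "herm N Q'" unfolding Q'_def using hQ hR by simp
    have "Q' * Q' = Q * Q + R * Q + (Q * R + R * R)"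
      unfolding Q'_def
      using add_mult_distrib_mat[OF Qc Rc, of Q N] add_mult_distrib_mat[OF Qc Rc, of R N] Qc Rc
        mult_add_distrib_mat[of "Q + R" N N Q N R] by simp
    then have "Q' * Q' = Q'" unfolding QQ RQ QR RR Q'_def using Qc Rc by simp
    moreover have "Q' *\<^sub>v v \<in> W" if v: "v \<in> carrier_vec N" for v
    proof -
      have "R *\<^sub>v v = complex_of_real (1 / c) \<cdot>\<^sub>v (outer u *\<^sub>v v)"
        unfolding R_def using Oc v by (intro eq_vecI) auto
      also have "\<dots> = complex_of_real (1 / c) \<cdot>\<^sub>v ((v \<bullet>c u) \<cdot>\<^sub>v u)"
        unfolding outer_mult_vec[OF u v] ..
      also have "\<dots> \<in> W" by (intro Wsmult uW)
      finally have "R *\<^sub>v v \<in> W" .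
      then show ?thesis
        unfolding Q'_def add_mult_distrib_mat_vec[OF Qc Rc v] by (rule Wadd[OF QW[OF v]])
    qed
    ultimately have "good Q'" using Q' unfolding good_def by simp
    moreover have "rtr R = 1"
      unfolding R_def rtr_smult[OF Oc] rtr_outer[OF u] c_def[symmetric] using c by simp
    then have "rtr Q' = rtr Q + 1"
      unfolding Q'_def rtr_add[OF Qc Rc] by simp
    ultimately show ?thesis by blast
  qed
  have "\<exists>Q. good Q \<and> (\<forall>w\<in>W. Q *\<^sub>v w = w)"
  proof (rule ccontr)
    assume contra: "\<not> ?thesis"
    \<comment> \<open>If no good projection fixed \<open>W\<close> pointwise, enlarging from 0 would
      produce one of trace \<open>k\<close> for every \<open>k\<close>, and \<open>Suc N\<close> is
      too large.\<close>
    have "\<exists>Q. good Q \<and> rtr Q = real k" for k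
    proof (induct k)
      case 0
      have "0\<^sub>m N N *\<^sub>v v = 0\<^sub>v N" if "v \<in> carrier_vec N" for v :: "complex vec"
        using that by (intro eq_vecI) auto
      then have "good (0\<^sub>m N N)"
        unfolding good_def herm_def using W0 by (auto intro!: eq_matI)
      then show ?case by (intro exI[of _ "0\<^sub>m N N"]) (simp add: rtr_def mat_trace_def)
    next
      case (Suc k)
      then obtain Q where Q: "good Q" "rtr Q = real k" by auto
      then obtain w where "w \<in> W" "Q *\<^sub>v w \<noteq> w" using contra by auto
      from extend[OF Q(1) this] Q(2) show ?case by auto
    qed
    then obtain Q where "good Q" "rtr Q = real (Suc N)" by blast
    then show False using rtr_projection_le[of N Q] unfolding good_def by simp
  qed
  then obtain Q where Q: "herm N Q" "Q * Q = Q" "\<And>v. v \<in> carrier_vec N \<Longrightarrow> Q *\<^sub>v v \<in> W"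
    and fix_W: "\<And>w. w \<in> W \<Longrightarrow> Q *\<^sub>v w = w" unfolding good_def by auto
  note Qc = herm_carrier[OF Q(1)]
  have "(v - Q *\<^sub>v v) \<bullet>c w = 0" if v: "v \<in> carrier_vec N" and w: "w \<in> W" for v w
  proof -
    have wc: "w \<in> carrier_vec N" and Qv: "Q *\<^sub>v v \<in> carrier_vec N" using w W Qc v by auto
    \<comment> \<open>Since \<open>Q\<close> fixes \<open>w\<close> and is self-adjoint, it can be
      moved onto the residual of \<open>v\<close>, which it annihilates.\<close>
    have "(v - Q *\<^sub>v v) \<bullet>c w = (v - Q *\<^sub>v v) \<bullet>c (Q *\<^sub>v w)" using fix_W[OF w] by simp
    also have "\<dots> = (Q *\<^sub>v (v - Q *\<^sub>v v)) \<bullet>c w"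
      using adjoint_scalar_prod[OF Qc _ wc, of "v - Q *\<^sub>v v"] v Qv Q(1) by simp
    also have "Q *\<^sub>v (v - Q *\<^sub>v v) = Q *\<^sub>v v - Q *\<^sub>v (Q *\<^sub>v v)"
      by (rule mult_minus_distrib_mat_vec[OF Qc v Qv])
    also have "Q *\<^sub>v (Q *\<^sub>v v) = Q *\<^sub>v v"
      using assoc_mult_mat_vec[OF Qc Qc v] Q(2) by simp
    finally show ?thesis using Qv wc by simp
  qed
  then show ?thesis using Q by blast
qed

text \<open>\<open>orth_proj\<close> is a definite description. Existence comes from
  \<open>orthogonal_projection_exists\<close>; uniqueness holds because the difference of two
  candidate images of a vector lies in \<open>W\<close> and is orthogonal to
  \<open>W\<close>.\<close>

lemma orth_proj_properties:
  assumes "is_subspace n W"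
  shows "herm (2 ^ n) (orth_proj n W) \<and> orth_proj n W * orth_proj n W = orth_proj n W"
proof -
  let ?N = "2 ^ n :: nat"
  interpret S: VectorSpace.subspace class_ring W "module_vec TYPE(complex) ?N"
    using assms unfolding is_subspace_def .
  note sub = S.submod[unfolded submodule_def]
  have W: "W \<subseteq> carrier_vec ?N" and W0: "0\<^sub>v ?N \<in> W"
    and Wadd: "\<And>v w. v \<in> W \<Longrightarrow> w \<in> W \<Longrightarrow> v + w \<in> W"
    and Wsmult: "\<And>c v. v \<in> W \<Longrightarrow> c \<cdot>\<^sub>v v \<in> W"
    using sub by (auto simp: module_vec_def)
  obtain Q where Q: "herm ?N Q" "Q * Q = Q"
    and QW: "\<And>v. v \<in> carrier_vec ?N \<Longrightarrow> Q *\<^sub>v v \<in> W"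
    and Qo: "\<And>v w. v \<in> carrier_vec ?N \<Longrightarrow> w \<in> W \<Longrightarrow> (v - Q *\<^sub>v v) \<bullet>c w = 0"
    using orthogonal_projection_exists[OF W W0 Wadd Wsmult] by auto
  note Qc = herm_carrier[OF Q(1)]
  have "orth_proj n W = Q"
    unfolding orth_proj_def
  proof (rule the_equality)
    show "Q \<in> carrier_mat ?N ?N \<and>
      (\<forall>v \<in> carrier_vec ?N. Q *\<^sub>v v \<in> W \<and> (\<forall>w \<in> W. (v - Q *\<^sub>v v) \<bullet>c w = 0))"
      using Qc QW Qo by blast
  next
    fix P assume P: "P \<in> carrier_mat ?N ?N \<and>
      (\<forall>v \<in> carrier_vec ?N. P *\<^sub>v v \<in> W \<and> (\<forall>w \<in> W. (v - P *\<^sub>v v) \<bullet>c w = 0))"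
    then have Pc: "P \<in> carrier_mat ?N ?N" by blast
    show "P = Q"
    proof (rule mat_eq_by_vec[OF Pc Qc])
      fix v :: "complex vec" assume v: "v \<in> carrier_vec ?N"
      have Pv: "P *\<^sub>v v \<in> carrier_vec ?N" and Qv: "Q *\<^sub>v v \<in> carrier_vec ?N" using Pc Qc v by auto
      define d where "d = P *\<^sub>v v - Q *\<^sub>v v"
      have d: "d \<in> carrier_vec ?N" unfolding d_def using Pv Qv by simp
      have "d = P *\<^sub>v v + (-1) \<cdot>\<^sub>v (Q *\<^sub>v v)" unfolding d_def using Pv Qv by (intro eq_vecI) auto
      then have dW: "d \<in> W" using Wadd[OF _ Wsmult[OF QW[OF v], of "-1"]] P v by simp
      have "p - q = (v - q) - (v - p)" if "p \<in> carrier_vec ?N" "q \<in> carrier_vec ?N" for p q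
        using that v by (intro eq_vecI) auto
      then have "d = (v - Q *\<^sub>v v) - (v - P *\<^sub>v v)" unfolding d_def using Pv Qv by blast
      then have "d \<bullet>c d = (v - Q *\<^sub>v v) \<bullet>c d - (v - P *\<^sub>v v) \<bullet>c d"
        using minus_scalar_prod_distrib[of "v - Q *\<^sub>v v" ?N "v - P *\<^sub>v v" "conjugate d"] Pv Qv v d
        by (simp add: carrier_vec_conjugate)
      then have "d \<bullet>c d = 0" using Qo[OF v dW] P v dW by simp
      then have "d = 0\<^sub>v ?N" using d by simp
      then show "P *\<^sub>v v = Q *\<^sub>v v" using minus_vec_eq_zero[OF Pv Qv] unfolding d_def by simp
    qed
  qed
  then show ?thesis using Q by simp
qed

section \<open>The maps \<open>d_j\<close> in coordinates\<close>

text \<open>The basis expansion in the identity factor collapses by \<open>sum_mat_unit\<close>, so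
  the low index parts \<open>r mod b\<close> and \<open>s mod b\<close> are merely carried
  along.\<close>

lemma tensor_map_id_right:
  assumes S: "\<And>i j. S (mat_unit a i j) \<in> carrier_mat a a" and rs: "r < a * b" "s < a * b"
  shows "tensor_map a b S (\<lambda>X. X) X $$ (r, s) =
    (\<Sum>i<a. \<Sum>j<a. X $$ (i * b + r mod b, j * b + s mod b) * S (mat_unit a i j) $$ (r div b, s div b))"
proof -
  have b: "b > 0" using rs by (cases b) auto
  have m: "r mod b < b" "s mod b < b" using b by auto
  have mu: "mat_unit b i j \<in> carrier_mat b b" for i j by (simp add: mat_unit_def)
  have "tensor_map a b S (\<lambda>X. X) X $$ (r, s) = (\<Sum>i<a. \<Sum>j<a. \<Sum>k<b. \<Sum>l<b.
      (X $$ (i * b + k, j * b + l) * S (mat_unit a i j) $$ (r div b, s div b)) * mat_unit b k l $$ (r mod b, s mod b))"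
    unfolding tensor_map_def using rs by (simp add: kron_index[OF S mu] mult.assoc)
  then show ?thesis unfolding sum_mat_unit[OF m] .
qed

lemma tensor_map_id_left:
  assumes T: "\<And>i j. T (mat_unit b i j) \<in> carrier_mat b b" and rs: "r < a * b" "s < a * b"
  shows "tensor_map a b (\<lambda>X. X) T X $$ (r, s) =
    (\<Sum>k<b. \<Sum>l<b. X $$ (r div b * b + k, s div b * b + l) * T (mat_unit b k l) $$ (r mod b, s mod b))"
proof -
  have m: "r div b < a" "s div b < a" using rs by (auto simp: less_mult_imp_div_less)
  have mu: "mat_unit a i j \<in> carrier_mat a a" for i j by (simp add: mat_unit_def)
  have "tensor_map a b (\<lambda>X. X) T X $$ (r, s) = (\<Sum>i<a. \<Sum>j<a. \<Sum>k<b. \<Sum>l<b.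
      X $$ (i * b + k, j * b + l) * (mat_unit a i j $$ (r div b, s div b) * T (mat_unit b k l) $$ (r mod b, s mod b)))"
    unfolding tensor_map_def using rs by (simp add: kron_index[OF mu T])
  also have "\<dots> = (\<Sum>i<a. \<Sum>j<a. (\<Sum>k<b. \<Sum>l<b.
      X $$ (i * b + k, j * b + l) * T (mat_unit b k l) $$ (r mod b, s mod b)) * mat_unit a i j $$ (r div b, s div b))"
    unfolding sum_distrib_right by (intro sum.cong refl) (simp only: mult_ac)
  finally show ?thesis unfolding sum_mat_unit[OF m] .
qed

text \<open>For \<open>b\<close> a power of two, this overwrites the binary digit of \<open>r\<close> of place value \<open>b\<close> by \<open>k\<close>. Tensor factor \<open>j\<close>
  of \<open>n\<close> is the digit of place value \<open>2 ^ (n - j)\<close>.\<close>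

definition set_digit :: "nat \<Rightarrow> nat \<Rightarrow> nat \<Rightarrow> nat" where
  "set_digit b k r = (r div b div 2 * 2 + k) * b + r mod b"

text \<open>Adding a multiple of \<open>2 * b\<close> affects neither the digit of place value
  \<open>b\<close> nor the part below it. With \<open>M = 2 ^ n\<close> the shift passes to the
  second half of the index range.\<close>

lemma set_digit_shift:
  assumes "b > 0" "2 * b dvd M"
  shows "set_digit b k (M + r) = M + set_digit b k r" "(M + r) div b mod 2 = r div b mod 2"
proof -
  obtain c where M: "M = 2 * b * c" using assms(2) by blast
  have d: "(M + r) div b = 2 * c + r div b" and m: "(M + r) mod b = r mod b"
    unfolding M using assms(1) by (simp_all add: mult.assoc mult.left_commute[of 2 b])
  show "(M + r) div b mod 2 = r div b mod 2" unfolding d by simp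
  show "set_digit b k (M + r) = M + set_digit b k r"
    unfolding set_digit_def d m by (simp add: M algebra_simps)
qed

lemma set_digit_less:
  assumes "2 * b dvd M" "r < M" "k < 2"
  shows "set_digit b k r < M"
proof -
  obtain c where M: "M = 2 * b * c" using assms(1) by blast
  have b: "b > 0" using assms(2) M by (cases b) auto
  have "r < 2 * c * b" using assms(2) M by (simp add: mult_ac)
  then have "r div b < 2 * c" by (rule less_mult_imp_div_less)
  then have "r div b div 2 < c" by (simp add: less_mult_imp_div_less mult.commute)
  then have "r div b div 2 * 2 + k < 2 * c" using assms(3) by linarith
  then have "set_digit b k r < 2 * c * b" unfolding set_digit_def using b by (intro pair_index_less) auto
  then show ?thesis using M by (simp add: mult_ac)
qed

lemma d_map_carrier:
  assumes "1 \<le> j" "j \<le> n"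
  shows "d_map n j X \<in> carrier_mat (2 ^ n) (2 ^ n)"
proof -
  have "(2::nat) ^ (j - 1) * 2 * 2 ^ (n - j) = 2 ^ n"
    using assms by (simp add: power_add[symmetric] power_Suc2[symmetric] del: power_Suc)
  then show ?thesis unfolding d_map_def tensor_map_def by simp
qed

lemma d_map_dim:
  assumes "1 \<le> j" "j \<le> n"
  shows "dim_row (d_map n j X) = 2 ^ n" "dim_col (d_map n j X) = 2 ^ n"
  using d_map_carrier[OF assms, of X] by auto

lemma block_weight_dvd:
  assumes "1 \<le> j" "j \<le> n"
  shows "2 * 2 ^ (n - j) dvd (2 ^ n :: nat)"
  using assms unfolding power_Suc[symmetric] by (intro le_imp_power_dvd) simp

text \<open>The subtracted term is half the partial trace over tensor factor \<open>j\<close>,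
  tensored with the identity there: it appears only where the two digits agree, and it averages over
  their common value.\<close>

lemma d_map_index:
  assumes j: "1 \<le> j" "j \<le> n" and rs: "r < 2 ^ n" "s < 2 ^ n" and b: "b = 2 ^ (n - j)"
  shows "d_map n j X $$ (r, s) = X $$ (r, s) -
    (if r div b mod 2 = s div b mod 2 then (\<Sum>k<2. X $$ (set_digit b k r, set_digit b k s)) / 2 else 0)"
proof -
  define a :: nat where "a = 2 ^ (j - 1)"
  have ab: "a * 2 * b = 2 ^ n"
    unfolding a_def b using j by (simp add: power_add[symmetric] power_Suc2[symmetric] del: power_Suc)
  let ?F = "tensor_map a 2 (\<lambda>X. X) traceless_part"
  \<comment> \<open>\<open>Y\<close> freezes the index parts below factor \<open>j\<close>, so that
    the trailing identity factor drops out.\<close>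
  define Y where "Y = mat (a * 2) (a * 2) (\<lambda>(i, j). X $$ (i * b + r mod b, j * b + s mod b))"
  have rb: "r div b < a * 2" "s div b < a * 2" using rs ab by (auto simp: less_mult_imp_div_less)
  have F: "?F Z \<in> carrier_mat (a * 2) (a * 2)" for Z by (simp add: tensor_map_def)
  have tp: "traceless_part (mat_unit 2 k l) \<in> carrier_mat 2 2" for k l
    by (auto simp: traceless_part_def mat_unit_def)
  have "d_map n j X $$ (r, s) = (\<Sum>i<a * 2. \<Sum>j<a * 2.
      X $$ (i * b + r mod b, j * b + s mod b) * ?F (mat_unit (a * 2) i j) $$ (r div b, s div b))"
    unfolding d_map_def a_def[symmetric] b[symmetric] using rs ab F by (intro tensor_map_id_right) auto
  also have "\<dots> = ?F Y $$ (r div b, s div b)"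
    unfolding tensor_map_expand[OF rb, of _ _ Y] by (intro sum.cong refl) (simp add: Y_def)
  also have "\<dots> = (\<Sum>k<2. \<Sum>l<2. Y $$ (r div b div 2 * 2 + k, s div b div 2 * 2 + l) *
      traceless_part (mat_unit 2 k l) $$ (r div b mod 2, s div b mod 2))"
    by (rule tensor_map_id_left) (use tp rb in auto)
  also have "\<dots> = (\<Sum>k<2. \<Sum>l<2. mat 2 2 (\<lambda>(k, l). Y $$ (r div b div 2 * 2 + k, s div b div 2 * 2 + l)) $$ (k, l) *
      traceless_part (mat_unit 2 k l) $$ (r div b mod 2, s div b mod 2))"
    by (intro sum.cong refl) simp
  also have "\<dots> = traceless_part (mat 2 2 (\<lambda>(k, l). Y $$ (r div b div 2 * 2 + k, s div b div 2 * 2 + l))) $$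
      (r div b mod 2, s div b mod 2)"
    by (rule traceless_part_expand[symmetric]) auto
  also have "\<dots> = Y $$ (r div b, s div b) - (if r div b mod 2 = s div b mod 2
      then (\<Sum>k<2. Y $$ (r div b div 2 * 2 + k, s div b div 2 * 2 + k)) / 2 else 0)"
    by (simp add: traceless_part_def mat_trace_def div_mult_mod_eq)
  also have "Y $$ (r div b, s div b) = X $$ (r, s)"
    using rb by (simp add: Y_def div_mult_mod_eq)
  also have "(\<Sum>k<2. Y $$ (r div b div 2 * 2 + k, s div b div 2 * 2 + k)) =
      (\<Sum>k<2. X $$ (set_digit b k r, set_digit b k s))"
  proof (intro sum.cong refl)
    fix k :: nat assume "k \<in> {..<2}"
    moreover have "r div b div 2 < a" "s div b div 2 < a"
      using rb by (auto intro: less_mult_imp_div_less)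
    ultimately have "r div b div 2 * 2 + k < a * 2" "s div b div 2 * 2 + k < a * 2" by auto
    then show "Y $$ (r div b div 2 * 2 + k, s div b div 2 * 2 + k) = X $$ (set_digit b k r, set_digit b k s)"
      by (simp add: Y_def set_digit_def)
  qed
  finally show ?thesis .
qed

lemma d_map_linear:
  assumes j: "1 \<le> j" "j \<le> n"
    and A: "A \<in> carrier_mat (2 ^ n) (2 ^ n)" and B: "B \<in> carrier_mat (2 ^ n) (2 ^ n)"
  shows "d_map n j (A + c \<cdot>\<^sub>m B) = d_map n j A + c \<cdot>\<^sub>m d_map n j B"
proof (rule eq_matI)
  note D = d_map_carrier[OF j]
  fix r s assume "r < dim_row (d_map n j A + c \<cdot>\<^sub>m d_map n j B)" "s < dim_col (d_map n j A + c \<cdot>\<^sub>m d_map n j B)"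
  then have rs: "r < 2 ^ n" "s < 2 ^ n" using D[of B] by auto
  have l: "set_digit (2 ^ (n - j)) k r < 2 ^ n" "set_digit (2 ^ (n - j)) k s < 2 ^ n" if "k < 2" for k
    using that rs block_weight_dvd[OF j] by (auto intro: set_digit_less)
  show "d_map n j (A + c \<cdot>\<^sub>m B) $$ (r, s) = (d_map n j A + c \<cdot>\<^sub>m d_map n j B) $$ (r, s)"
    using rs l A B D[of A] D[of B]
    by (simp add: d_map_index[OF j rs refl] sum_distrib_left numeral_2_eq_2 algebra_simps add_divide_distrib)
qed (simp_all add: d_map_dim[OF j])

text \<open>Factor 1 is the leading binary digit, that is, the block index; removing the partial
  trace subtracts \<open>(A + D) / 2\<close> from both diagonal blocks.\<close>

lemma d_map_four_block_first:
  assumes c: "A \<in> carrier_mat (2 ^ n) (2 ^ n)" "B \<in> carrier_mat (2 ^ n) (2 ^ n)"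
    "C \<in> carrier_mat (2 ^ n) (2 ^ n)" "D \<in> carrier_mat (2 ^ n) (2 ^ n)"
  shows "d_map (Suc n) 1 (four_block_mat A B C D) =
    four_block_mat ((1 / 2) \<cdot>\<^sub>m (A - D)) B C ((1 / 2) \<cdot>\<^sub>m (D - A))"
proof (rule eq_matI)
  let ?R = "four_block_mat ((1 / 2) \<cdot>\<^sub>m (A - D)) B C ((1 / 2) \<cdot>\<^sub>m (D - A))"
  fix r s assume "r < dim_row ?R" "s < dim_col ?R"
  then have rs: "r < 2 ^ Suc n" "s < 2 ^ Suc n" using c by auto
  have digit: "x div 2 ^ n = (if x < 2 ^ n then 0 else 1)" "x mod 2 ^ n = (if x < 2 ^ n then x else x - 2 ^ n)"
    if "x < 2 ^ Suc n" for x :: nat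
    using that by (auto simp: div_if mod_if le_less_trans not_less)
  have "d_map (Suc n) 1 (four_block_mat A B C D) $$ (r, s) = four_block_mat A B C D $$ (r, s) -
    (if r div 2 ^ n mod 2 = s div 2 ^ n mod 2 then
      (\<Sum>k<2. four_block_mat A B C D $$ (set_digit (2 ^ n) k r, set_digit (2 ^ n) k s)) / 2 else 0)"
    using rs by (intro d_map_index) auto
  also have "\<dots> = ?R $$ (r, s)"
    using rs c unfolding set_digit_def digit[OF rs(1)] digit[OF rs(2)]
    by (cases "r < 2 ^ n"; cases "s < 2 ^ n") (auto simp: numeral_2_eq_2 field_simps)
  finally show "d_map (Suc n) 1 (four_block_mat A B C D) $$ (r, s) = ?R $$ (r, s)" .
qed (use c in \<open>simp_all add: d_map_dim\<close>)

text \<open>Factor \<open>Suc j\<close> of \<open>Suc n\<close> has the same place value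
  \<open>2 ^ (n - j)\<close> as factor \<open>j\<close> of \<open>n\<close>, so the leading digit is
  never touched and the map acts inside each block.\<close>

lemma d_map_four_block_later:
  assumes j: "1 \<le> j" "j \<le> n"
    and c: "A \<in> carrier_mat (2 ^ n) (2 ^ n)" "B \<in> carrier_mat (2 ^ n) (2 ^ n)"
      "C \<in> carrier_mat (2 ^ n) (2 ^ n)" "D \<in> carrier_mat (2 ^ n) (2 ^ n)"
  shows "d_map (Suc n) (Suc j) (four_block_mat A B C D) =
    four_block_mat (d_map n j A) (d_map n j B) (d_map n j C) (d_map n j D)"
proof (rule eq_matI)
  let ?R = "four_block_mat (d_map n j A) (d_map n j B) (d_map n j C) (d_map n j D)"
  note Dc = d_map_carrier[OF j]
  have dd: "d_map n j Z \<in> carrier_mat (2 ^ n) (2 ^ n)" "dim_row (d_map n j Z) = 2 ^ n" "dim_col (d_map n j Z) = 2 ^ n" for Z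
    using Dc[of Z] by auto
  fix r s assume "r < dim_row ?R" "s < dim_col ?R"
  then have rs: "r < 2 ^ Suc n" "s < 2 ^ Suc n" using dd by auto
  let ?b = "2 ^ (n - j) :: nat"
  have dvd: "2 * ?b dvd 2 ^ n" by (rule block_weight_dvd[OF j])
  have sh: "set_digit ?b k (2 ^ n + x) = 2 ^ n + set_digit ?b k x" "(2 ^ n + x) div ?b mod 2 = x div ?b mod 2" for k x
    using set_digit_shift[OF _ dvd] by auto
  have l: "set_digit ?b k x < 2 ^ n" if "x < 2 ^ n" "k < 2" for k x
    using set_digit_less[OF dvd that] .
  have cases: "\<exists>\<beta> y. x = (if \<beta> then 2 ^ n + y else y) \<and> y < 2 ^ n" if "x < 2 ^ Suc n" for x :: nat
  proof (cases "x < 2 ^ n")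
    case True
    then show ?thesis by (intro exI[of _ False] exI[of _ x]) simp
  next
    case False
    then show ?thesis using that by (intro exI[of _ True] exI[of _ "x - 2 ^ n"]) simp
  qed
  obtain p r' where r: "r = (if p then 2 ^ n + r' else r')" "r' < 2 ^ n" using cases[OF rs(1)] by blast
  obtain q s' where s: "s = (if q then 2 ^ n + s' else s')" "s' < 2 ^ n" using cases[OF rs(2)] by blast
  have b: "?b = 2 ^ (Suc n - Suc j)" by simp
  \<comment> \<open>\<open>p\<close> and \<open>q\<close> are the leading digits of \<open>r\<close>
    and \<open>s\<close>; every entry in the index formula lies in the same block
    \<open>X\<close>.\<close>
  define X where "X = (if p then (if q then D else C) else (if q then B else A))"
  have blk: "four_block_mat A B C D $$ ((if p then 2 ^ n + x else x), (if q then 2 ^ n + y else y)) = X $$ (x, y)"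
    if "x < 2 ^ n" "y < 2 ^ n" for x y
    using that c unfolding X_def by auto
  have blk': "?R $$ (r, s) = d_map n j X $$ (r', s')"
    using r s dd unfolding X_def by auto
  have sr: "set_digit ?b k r = (if p then 2 ^ n + set_digit ?b k r' else set_digit ?b k r')"
    "set_digit ?b k s = (if q then 2 ^ n + set_digit ?b k s' else set_digit ?b k s')" for k
    using sh r s by auto
  have dr: "r div ?b mod 2 = r' div ?b mod 2" "s div ?b mod 2 = s' div ?b mod 2"
    using sh r s by auto
  have "d_map (Suc n) (Suc j) (four_block_mat A B C D) $$ (r, s) = four_block_mat A B C D $$ (r, s) -
    (if r div ?b mod 2 = s div ?b mod 2 then
      (\<Sum>k<2. four_block_mat A B C D $$ (set_digit ?b k r, set_digit ?b k s)) / 2 else 0)"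
    using j rs by (intro d_map_index) auto
  also have "(\<Sum>k<2. four_block_mat A B C D $$ (set_digit ?b k r, set_digit ?b k s)) =
      (\<Sum>k<2. X $$ (set_digit ?b k r', set_digit ?b k s'))"
    unfolding sr using l r(2) s(2) by (intro sum.cong refl blk) auto
  also have "four_block_mat A B C D $$ (r, s) = X $$ (r', s')"
    unfolding r(1) s(1) by (rule blk[OF r(2) s(2)])
  finally show "d_map (Suc n) (Suc j) (four_block_mat A B C D) $$ (r, s) = ?R $$ (r, s)"
    unfolding blk' dr using d_map_index[OF j r(2) s(2) refl] by simp
qed (use c j in \<open>simp_all add: d_map_dim\<close>)

section \<open>Fourth moments\<close>

lemma herm_zero [simp]: "herm N (0\<^sub>m N N)"
  unfolding herm_def by (auto intro!: eq_matI)

lemma sq_carrier: "A \<in> carrier_mat N N \<Longrightarrow> B \<in> carrier_mat N N \<Longrightarrow> A * B \<in> carrier_mat N N"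
  by (rule mult_carrier_mat)

lemma herm_anticommutator:
  assumes X: "herm N X" and Y: "herm N Y"
  shows "herm N (X * Y + Y * X)"
proof -
  note Xc = herm_carrier[OF X] and Yc = herm_carrier[OF Y]
  have "mat_adjoint (X * Y + Y * X) = Y * X + X * Y"
    using mat_adjoint_add[OF sq_carrier[OF Xc Yc] sq_carrier[OF Yc Xc]] mat_adjoint_mult[OF Xc Yc]
      mat_adjoint_mult[OF Yc Xc] X Y by simp
  also have "\<dots> = X * Y + Y * X" using comm_add_mat[OF sq_carrier[OF Yc Xc] sq_carrier[OF Xc Yc]] .
  finally show ?thesis unfolding herm_def using sq_carrier[OF Yc Xc] sq_carrier[OF Xc Yc] by simp
qed

lemma rtr_mult_add_add:
  assumes "A \<in> carrier_mat N N" "B \<in> carrier_mat N N" "C \<in> carrier_mat N N" "D \<in> carrier_mat N N"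
  shows "rtr ((A + B) * (C + D)) = rtr (A * C) + rtr (A * D) + rtr (B * C) + rtr (B * D)"
  using assms
  by (simp add: add_mult_distrib_mat[of _ N N _ _ N] mult_add_distrib_mat[of _ N N _ N]
      rtr_add[of _ N] sq_carrier)

lemma rtr_mult_minus_minus:
  assumes c: "A \<in> carrier_mat N N" "B \<in> carrier_mat N N" "C \<in> carrier_mat N N" "D \<in> carrier_mat N N"
  shows "rtr ((A - B) * (C - D)) = rtr (A * C) - rtr (A * D) - rtr (B * C) + rtr (B * D)"
proof -
  have cd: "C - D \<in> carrier_mat N N" by (rule minus_carrier_mat[OF c(4)])
  have "(A - B) * (C - D) = A * (C - D) - B * (C - D)"
    by (rule minus_mult_distrib_mat[OF c(1,2) cd])
  also have "\<dots> = (A * C - A * D) - (B * C - B * D)"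
    unfolding mult_minus_distrib_mat[OF c(1,3,4)] mult_minus_distrib_mat[OF c(2,3,4)] ..
  finally show ?thesis
    using sq_carrier[OF c(1,3)] sq_carrier[OF c(1,4)] sq_carrier[OF c(2,3)] sq_carrier[OF c(2,4)]
    by (simp add: rtr_minus[of _ N] minus_carrier_mat[of _ N N])
qed

text \<open>The difference of both sides is the squared norm of the commutator.\<close>

lemma anticommutator_norm_le:
  assumes X: "herm N X" and Y: "herm N Y"
  shows "rtr ((X * Y + Y * X) * (X * Y + Y * X)) \<le> 4 * rtr (X * X * (Y * Y))"
proof -
  note Xc = herm_carrier[OF X] and Yc = herm_carrier[OF Y]
  note [simp] = sq_carrier and assoc = assoc_mult_mat[of _ N N _ N _ N]
  have XY: "X * Y \<in> carrier_mat N N" and YX: "Y * X \<in> carrier_mat N N" using Xc Yc by auto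
  have q: "rtr (Y * X * (X * Y)) = rtr (X * X * (Y * Y))" "rtr (X * Y * (Y * X)) = rtr (X * X * (Y * Y))"
  proof -
    have "rtr (Y * X * (X * Y)) = rtr (Y * (X * X * Y))" using Xc Yc by (simp add: assoc)
    also have "\<dots> = rtr (X * X * Y * Y)" using Xc Yc by (intro rtr_comm[of _ N N]) auto
    finally show "rtr (Y * X * (X * Y)) = rtr (X * X * (Y * Y))" using Xc Yc by (simp add: assoc)
    have "rtr (X * Y * (Y * X)) = rtr (X * Y * Y * X)" using Xc Yc by (simp add: assoc)
    also have "\<dots> = rtr (X * (X * Y * Y))" using Xc Yc by (intro rtr_comm[of _ N N]) auto
    finally show "rtr (X * Y * (Y * X)) = rtr (X * X * (Y * Y))" using Xc Yc by (simp add: assoc)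
  qed
  have "mat_adjoint (X * Y - Y * X) = Y * X - X * Y"
    using mat_adjoint_minus[OF XY YX] mat_adjoint_mult[OF Xc Yc] mat_adjoint_mult[OF Yc Xc] X Y by simp
  then have "0 \<le> rtr ((Y * X - X * Y) * (X * Y - Y * X))"
    using mat_trace_adjoint_mult_nonneg[OF minus_carrier_mat[OF YX, of "X * Y"]] by (simp add: rtr_def)
  then show ?thesis
    unfolding rtr_mult_minus_minus[OF YX XY XY YX] rtr_mult_add_add[OF XY YX XY YX] q by simp
qed

text \<open>For Hermitian \<open>X\<close> this is the square of the unnormalized Schatten 4-norm.
  In squared form it compares linearly with sums of squared coefficients, which suits the
  hypercontractive induction.\<close>

definition m4 :: "complex mat \<Rightarrow> real" where
  "m4 X = sqrt (rtr (X * X * (X * X)))"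

lemma m4_nonneg: "herm N X \<Longrightarrow> 0 \<le> m4 X"
  unfolding m4_def using rtr_square_nonneg[OF herm_square] by simp

lemma m4_square: "herm N X \<Longrightarrow> (m4 X)\<^sup>2 = rtr (X * X * (X * X))"
  unfolding m4_def using rtr_square_nonneg[OF herm_square] by simp

lemma two_mult_le_of_square_le:
  fixes a b t :: real
  assumes "t\<^sup>2 \<le> a * b" "0 \<le> a" "0 \<le> b"
  shows "2 * t \<le> a + b"
proof -
  have "(2 * t)\<^sup>2 \<le> 4 * (a * b)" using assms(1) by (simp add: power_mult_distrib)
  also have "\<dots> \<le> (a + b)\<^sup>2" using zero_le_power2[of "a - b"] by (simp add: power2_eq_square algebra_simps)
  finally show ?thesis by (rule power2_le_imp_le) (use assms(2,3) in simp)
qed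

text \<open>The square of \<open>X + Y\<close> splits into \<open>X * X + Y * Y\<close> and the
  anticommutator \<open>H\<close>, and the fourth moment is the squared Hilbert-Schmidt norm of that
  sum.\<close>

lemma m4_expansion:
  assumes X: "herm N X" and Y: "herm N Y"
  defines "H \<equiv> X * Y + Y * X"
  shows "(m4 (X + Y))\<^sup>2 = rtr ((X * X + Y * Y) * (X * X + Y * Y)) +
      2 * rtr (X * X * H) + 2 * rtr (Y * Y * H) + rtr (H * H)"
    and "rtr ((X * X + Y * Y) * (X * X + Y * Y)) = (m4 X)\<^sup>2 + 2 * rtr (X * X * (Y * Y)) + (m4 Y)\<^sup>2"
proof -
  note Xc = herm_carrier[OF X] and Yc = herm_carrier[OF Y]
  note [simp] = sq_carrier
  have XX: "X * X \<in> carrier_mat N N" and YY: "Y * Y \<in> carrier_mat N N"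
    and XY: "X * Y \<in> carrier_mat N N" and YX: "Y * X \<in> carrier_mat N N" using Xc Yc by auto
  have H: "H \<in> carrier_mat N N" unfolding H_def using XY YX by simp
  have "(X + Y) * (X + Y) = X * X + Y * X + (X * Y + Y * Y)"
    using Xc Yc by (simp add: add_mult_distrib_mat[of _ N N _ _ N] mult_add_distrib_mat[of _ N N _ N])
  also have "\<dots> = (X * X + Y * Y) + H"
  proof -
    have "A + B + (C + D) = A + D + (C + B)"
      if "A \<in> carrier_mat N N" "B \<in> carrier_mat N N" "C \<in> carrier_mat N N" "D \<in> carrier_mat N N"
      for A B C D :: "complex mat"
      using that by (intro eq_matI) auto
    then show ?thesis unfolding H_def using XX YX XY YY by blast
  qed
  finally have Z: "(X + Y) * (X + Y) = (X * X + Y * Y) + H" .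
  have "(m4 (X + Y))\<^sup>2 = rtr ((X * X + Y * Y + H) * (X * X + Y * Y + H))"
    unfolding m4_square[OF herm_add[OF X Y]] Z ..
  also have "\<dots> = rtr ((X * X + Y * Y) * (X * X + Y * Y)) + 2 * rtr ((X * X + Y * Y) * H) + rtr (H * H)"
    using XX YY H rtr_comm[of H N N "X * X + Y * Y"] by (subst rtr_mult_add_add) auto
  also have "rtr ((X * X + Y * Y) * H) = rtr (X * X * H) + rtr (Y * Y * H)"
    using XX YY H by (simp add: add_mult_distrib_mat[of _ N N _ _ N] rtr_add[of _ N])
  finally show "(m4 (X + Y))\<^sup>2 = rtr ((X * X + Y * Y) * (X * X + Y * Y)) +
      2 * rtr (X * X * H) + 2 * rtr (Y * Y * H) + rtr (H * H)" by simp
  show "rtr ((X * X + Y * Y) * (X * X + Y * Y)) = (m4 X)\<^sup>2 + 2 * rtr (X * X * (Y * Y)) + (m4 Y)\<^sup>2"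
    unfolding m4_square[OF X] m4_square[OF Y]
    using XX YY rtr_comm[of "Y * Y" N N "X * X"] by (subst rtr_mult_add_add) auto
qed

lemma rtr_squares_le:
  assumes X: "herm N X" and Y: "herm N Y"
  shows "rtr (X * X * (Y * Y)) \<le> m4 X * m4 Y"
proof -
  have "(rtr (X * X * (Y * Y)))\<^sup>2 \<le> (m4 X * m4 Y)\<^sup>2"
    using rtr_Cauchy_Schwarz[OF herm_square[OF X] herm_square[OF Y]]
    unfolding power_mult_distrib m4_square[OF X] m4_square[OF Y] .
  then show ?thesis
    by (rule power2_le_imp_le) (intro mult_nonneg_nonneg m4_nonneg[OF X] m4_nonneg[OF Y])
qed

text \<open>The anticommutator \<open>?H\<close> has at most the norm of \<open>?S\<close>, because
  \<open>4 * rtr (X * X * (Y * Y))\<close> is at most \<open>rtr (?S * ?S)\<close>. Hence the square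
  of \<open>X + Y\<close> has at most twice the norm of \<open>?S\<close>, which in turn is at most
  \<open>m4 X + m4 Y\<close>.\<close>

lemma m4_add:
  assumes X: "herm N X" and Y: "herm N Y"
  shows "m4 (X + Y) \<le> 2 * (m4 X + m4 Y)"
proof (rule power2_le_imp_le)
  let ?H = "X * Y + Y * X" and ?S = "X * X + Y * Y"
  note Xc = herm_carrier[OF X] and Yc = herm_carrier[OF Y]
  have H: "herm N ?H" by (rule herm_anticommutator[OF X Y])
  have S: "herm N ?S" using X Y by simp
  note pos = m4_nonneg[OF X] m4_nonneg[OF Y]
  have h: "rtr (?H * ?H) \<le> 4 * rtr (X * X * (Y * Y))" by (rule anticommutator_norm_le[OF X Y])
  have "0 \<le> rtr ((X * X - Y * Y) * (X * X - Y * Y))" using X Y by (intro rtr_square_nonneg[of N]) auto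
  then have "2 * rtr (X * X * (Y * Y)) \<le> (m4 X)\<^sup>2 + (m4 Y)\<^sup>2"
    using Xc Yc rtr_comm[of "Y * Y" N N "X * X"] unfolding m4_square[OF X] m4_square[OF Y]
    by (subst (asm) rtr_mult_minus_minus[of _ N]) (auto simp: sq_carrier)
  then have hS: "rtr (?H * ?H) \<le> rtr (?S * ?S)" using h m4_expansion(2)[OF X Y] by simp
  have "2 * rtr (?S * ?H) \<le> rtr (?S * ?S) + rtr (?H * ?H)"
    by (intro two_mult_le_of_square_le rtr_Cauchy_Schwarz[of N] rtr_square_nonneg[of N] S H)
  moreover have "rtr (?S * ?H) = rtr (X * X * ?H) + rtr (Y * Y * ?H)"
    using Xc Yc herm_carrier[OF H]
    by (simp add: add_mult_distrib_mat[of _ N N _ _ N] rtr_add[of _ N] sq_carrier)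
  ultimately have "(m4 (X + Y))\<^sup>2 \<le> 4 * rtr (?S * ?S)"
    using m4_expansion(1)[OF X Y] hS by simp
  also have "\<dots> \<le> 4 * (m4 X + m4 Y)\<^sup>2"
    using m4_expansion(2)[OF X Y] rtr_squares_le[OF X Y] by (simp add: power2_sum)
  finally show "(m4 (X + Y))\<^sup>2 \<le> (2 * (m4 X + m4 Y))\<^sup>2" unfolding power_mult_distrib by simp
  show "0 \<le> 2 * (m4 X + m4 Y)" using pos by simp
qed

text \<open>Coefficient 1 of \<open>m4 X\<close>, which allows the iteration over tensor factors, is possible because the term of
  the fourth moment that is linear in \<open>Y\<close> vanishes.\<close>

lemma m4_add_centered:
  assumes X: "herm N X" and Y: "herm N Y" and centered: "rtr (X * X * X * Y) = 0"
  shows "m4 (X + Y) \<le> m4 X + 4 * m4 Y"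
proof (rule power2_le_imp_le)
  let ?H = "X * Y + Y * X"
  note Xc = herm_carrier[OF X] and Yc = herm_carrier[OF Y]
  note [simp] = sq_carrier and assoc = assoc_mult_mat[of _ N N _ N _ N]
  have H: "herm N ?H" by (rule herm_anticommutator[OF X Y])
  note pos = m4_nonneg[OF X] m4_nonneg[OF Y]
  have h: "rtr (?H * ?H) \<le> 4 * (m4 X * m4 Y)"
    using anticommutator_norm_le[OF X Y] rtr_squares_le[OF X Y] by simp
  \<comment> \<open>By cyclicity both terms equal the trace that is assumed to vanish.\<close>
  have "rtr (X * X * ?H) = rtr (X * X * (X * Y)) + rtr (X * X * (Y * X))"
    using Xc Yc by (simp add: mult_add_distrib_mat[of _ N N _ N] rtr_add[of _ N])
  moreover have "rtr (X * X * (X * Y)) = 0" using centered Xc Yc by (simp add: assoc)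
  moreover have "rtr (X * X * (Y * X)) = 0"
  proof -
    have "rtr (X * X * (Y * X)) = rtr (X * X * Y * X)" using Xc Yc by (simp add: assoc)
    also have "\<dots> = rtr (X * (X * X * Y))" using Xc Yc by (intro rtr_comm[of _ N N]) auto
    also have "\<dots> = rtr (X * X * X * Y)" using Xc Yc by (simp add: assoc)
    finally show ?thesis using centered by simp
  qed
  ultimately have XH: "rtr (X * X * ?H) = 0" by simp
  \<comment> \<open>Weighted arithmetic-geometric mean. Together with \<open>h\<close> and
    \<open>rtr_squares_le\<close>, the mixed terms sum to at most \<open>8 * (m4 X * m4 Y)\<close>,
    exactly the mixed term of the squared right-hand side with its coefficient 4.\<close>
  have "2 * rtr (Y * Y * ?H) \<le> 2 * (m4 Y)\<^sup>2 + rtr (?H * ?H) / 2"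
  proof (rule two_mult_le_of_square_le)
    show "(rtr (Y * Y * ?H))\<^sup>2 \<le> 2 * (m4 Y)\<^sup>2 * (rtr (?H * ?H) / 2)"
      using rtr_Cauchy_Schwarz[OF herm_square[OF Y] H] unfolding m4_square[OF Y] by simp
  qed (use rtr_square_nonneg[OF H] in simp_all)
  then have "(m4 (X + Y))\<^sup>2 \<le> (m4 X)\<^sup>2 + 2 * rtr (X * X * (Y * Y)) + 3 * (m4 Y)\<^sup>2 + 6 * (m4 X * m4 Y)"
    using m4_expansion[OF X Y] XH h by simp
  also have "\<dots> \<le> (m4 X + 4 * m4 Y)\<^sup>2"
  proof -
    have "(m4 X + 4 * m4 Y)\<^sup>2 = (m4 X)\<^sup>2 + 8 * (m4 X * m4 Y) + 16 * (m4 Y)\<^sup>2"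
      by (simp add: power2_eq_square algebra_simps)
    then show ?thesis using rtr_squares_le[OF X Y] zero_le_power2[of "m4 Y"] by linarith
  qed
  finally show "(m4 (X + Y))\<^sup>2 \<le> (m4 X + 4 * m4 Y)\<^sup>2" .
  show "0 \<le> m4 X + 4 * m4 Y" using pos by simp
qed

section \<open>Block matrices with Pauli components\<close>

text \<open>\<open>\<Sum>\<^sub>k \<sigma>\<^sub>k \<otimes> X\<^sub>k\<close> with the Pauli matrices in the first, most significant tensor factor.\<close>

definition pauli_block :: "complex mat \<Rightarrow> complex mat \<Rightarrow> complex mat \<Rightarrow> complex mat \<Rightarrow> complex mat" where
  "pauli_block X0 X1 X2 X3 =
    four_block_mat (X0 + X3) (X1 + (- \<i>) \<cdot>\<^sub>m X2) (X1 + \<i> \<cdot>\<^sub>m X2) (X0 + (- 1) \<cdot>\<^sub>m X3)"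

lemma pauli_block_carrier:
  assumes "X0 \<in> carrier_mat N N" "X3 \<in> carrier_mat N N"
  shows "pauli_block X0 X1 X2 X3 \<in> carrier_mat (2 * N) (2 * N)"
  using assms unfolding pauli_block_def mult_2 by (intro four_block_carrier_mat) auto

lemma herm_pauli_block:
  assumes "herm N X0" "herm N X1" "herm N X2" "herm N X3"
  shows "herm (2 * N) (pauli_block X0 X1 X2 X3)"
  unfolding herm_def
proof
  note c = assms[THEN herm_carrier]
  show C: "pauli_block X0 X1 X2 X3 \<in> carrier_mat (2 * N) (2 * N)"
    by (rule pauli_block_carrier[OF c(1,4)])
  have d: "dim_row X = N" "dim_col X = N" if "herm N X" for X
    using herm_carrier[OF that] by auto
  have e: "cnj (X $$ (j, i)) = X $$ (i, j)" if "herm N X" "i < N" "j < N" for X i j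
    using herm_index[OF that] by simp
  show "mat_adjoint (pauli_block X0 X1 X2 X3) = pauli_block X0 X1 X2 X3"
    by (rule eq_matI)
      (auto simp: pauli_block_def d[OF assms(1)] d[OF assms(2)] d[OF assms(3)] d[OF assms(4)]
        e[OF assms(1)] e[OF assms(2)] e[OF assms(3)] e[OF assms(4)])
qed

lemma rtr_pauli_block:
  assumes "X0 \<in> carrier_mat N N" "X3 \<in> carrier_mat N N"
  shows "rtr (pauli_block X0 X1 X2 X3) = 2 * rtr X0"
  unfolding rtr_def pauli_block_def using assms
  by (simp add: mat_trace_four_block[of _ N _ N] mat_trace_add[of _ N] mat_trace_smult[of _ N])

text \<open>Distinct Pauli matrices are orthogonal for the trace and the square of each has trace 2,
  so only equal slots survive, with factor 2.\<close>

lemma rtr_mult_pauli_block: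
  assumes X: "X0 \<in> carrier_mat N N" "X1 \<in> carrier_mat N N" "X2 \<in> carrier_mat N N" "X3 \<in> carrier_mat N N"
    and Y: "Y0 \<in> carrier_mat N N" "Y1 \<in> carrier_mat N N" "Y2 \<in> carrier_mat N N" "Y3 \<in> carrier_mat N N"
  shows "rtr (pauli_block X0 X1 X2 X3 * pauli_block Y0 Y1 Y2 Y3) =
    2 * (rtr (X0 * Y0) + rtr (X1 * Y1) + rtr (X2 * Y2) + rtr (X3 * Y3))"
proof -
  let ?T = "\<lambda>A B. \<Sum>i<N. \<Sum>j<N. A $$ (i, j) * B $$ (j, i)"
  have T: "mat_trace (A * B) = ?T A B" if "A \<in> carrier_mat N N" "B \<in> carrier_mat N N" for A B
    by (rule mat_trace_mult[OF that])
  have "mat_trace (pauli_block X0 X1 X2 X3 * pauli_block Y0 Y1 Y2 Y3) =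
      (?T (X0 + X3) (Y0 + Y3) + ?T (X1 + (- \<i>) \<cdot>\<^sub>m X2) (Y1 + \<i> \<cdot>\<^sub>m Y2)) +
      (?T (X1 + \<i> \<cdot>\<^sub>m X2) (Y1 + (- \<i>) \<cdot>\<^sub>m Y2) + ?T (X0 + (- 1) \<cdot>\<^sub>m X3) (Y0 + (- 1) \<cdot>\<^sub>m Y3))"
    unfolding pauli_block_def using X Y
    by (subst mult_four_block_mat[of _ N N _ N _ N _ _ N _ N])
      (simp_all add: mat_trace_four_block[of _ N _ N] mat_trace_add[of _ N] T sq_carrier)
  also have "\<dots> = 2 * (?T X0 Y0 + ?T X1 Y1 + ?T X2 Y2 + ?T X3 Y3)"
    unfolding sum.distrib[symmetric] sum_distrib_left
    using X Y by (intro sum.cong refl) (simp add: algebra_simps)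
  finally show ?thesis unfolding rtr_def T[OF X(1) Y(1)] T[OF X(2) Y(2)] T[OF X(3) Y(3)] T[OF X(4) Y(4)]
    by simp
qed

text \<open>Every Pauli matrix squares to the identity. Consequently the fourth moment of a single
  component does not depend on its slot.\<close>

lemma pauli_block_single_square:
  assumes Y: "Y \<in> carrier_mat N N"
  shows "pauli_block Y (0\<^sub>m N N) (0\<^sub>m N N) (0\<^sub>m N N) * pauli_block Y (0\<^sub>m N N) (0\<^sub>m N N) (0\<^sub>m N N) =
      pauli_block (Y * Y) (0\<^sub>m N N) (0\<^sub>m N N) (0\<^sub>m N N)"
    and "pauli_block (0\<^sub>m N N) Y (0\<^sub>m N N) (0\<^sub>m N N) * pauli_block (0\<^sub>m N N) Y (0\<^sub>m N N) (0\<^sub>m N N) =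
      pauli_block (Y * Y) (0\<^sub>m N N) (0\<^sub>m N N) (0\<^sub>m N N)"
    and "pauli_block (0\<^sub>m N N) (0\<^sub>m N N) Y (0\<^sub>m N N) * pauli_block (0\<^sub>m N N) (0\<^sub>m N N) Y (0\<^sub>m N N) =
      pauli_block (Y * Y) (0\<^sub>m N N) (0\<^sub>m N N) (0\<^sub>m N N)"
    and "pauli_block (0\<^sub>m N N) (0\<^sub>m N N) (0\<^sub>m N N) Y * pauli_block (0\<^sub>m N N) (0\<^sub>m N N) (0\<^sub>m N N) Y =
      pauli_block (Y * Y) (0\<^sub>m N N) (0\<^sub>m N N) (0\<^sub>m N N)"
proof -
  have z: "c \<cdot>\<^sub>m 0\<^sub>m N N = (0\<^sub>m N N :: complex mat)" for c by (intro eq_matI) auto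
  have YY: "Y * Y \<in> carrier_mat N N" by (rule sq_carrier[OF Y Y])
  have sq: "four_block_mat A B C D * four_block_mat A B C D =
      four_block_mat (A * A + B * C) (A * B + B * D) (C * A + D * C) (C * B + D * D)"
    if "A \<in> carrier_mat N N" "B \<in> carrier_mat N N" "C \<in> carrier_mat N N" "D \<in> carrier_mat N N"
    for A B C D :: "complex mat"
    using that by (intro mult_four_block_mat) auto
  have m: "(a \<cdot>\<^sub>m Y) * (b \<cdot>\<^sub>m Y) = (a * b) \<cdot>\<^sub>m (Y * Y)" for a b
  proof -
    have "(a \<cdot>\<^sub>m Y) * (b \<cdot>\<^sub>m Y) = a \<cdot>\<^sub>m (b \<cdot>\<^sub>m (Y * Y))"
      using mult_smult_assoc_mat[OF Y smult_carrier_mat[OF Y], of a b] mult_smult_distrib[OF Y Y, of b] by simp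
    then show ?thesis using YY by (intro eq_matI) auto
  qed
  have one: "1 \<cdot>\<^sub>m (Y * Y) = Y * Y" using YY by (intro eq_matI) auto
  show "pauli_block Y (0\<^sub>m N N) (0\<^sub>m N N) (0\<^sub>m N N) * pauli_block Y (0\<^sub>m N N) (0\<^sub>m N N) (0\<^sub>m N N) =
      pauli_block (Y * Y) (0\<^sub>m N N) (0\<^sub>m N N) (0\<^sub>m N N)"
    and "pauli_block (0\<^sub>m N N) Y (0\<^sub>m N N) (0\<^sub>m N N) * pauli_block (0\<^sub>m N N) Y (0\<^sub>m N N) (0\<^sub>m N N) =
      pauli_block (Y * Y) (0\<^sub>m N N) (0\<^sub>m N N) (0\<^sub>m N N)"
    and "pauli_block (0\<^sub>m N N) (0\<^sub>m N N) Y (0\<^sub>m N N) * pauli_block (0\<^sub>m N N) (0\<^sub>m N N) Y (0\<^sub>m N N) =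
      pauli_block (Y * Y) (0\<^sub>m N N) (0\<^sub>m N N) (0\<^sub>m N N)"
    and "pauli_block (0\<^sub>m N N) (0\<^sub>m N N) (0\<^sub>m N N) Y * pauli_block (0\<^sub>m N N) (0\<^sub>m N N) (0\<^sub>m N N) Y =
      pauli_block (Y * Y) (0\<^sub>m N N) (0\<^sub>m N N) (0\<^sub>m N N)"
    unfolding pauli_block_def z using Y YY
    by (simp_all add: sq m one)
qed

lemma m4_pauli_block_single:
  assumes Y: "Y \<in> carrier_mat N N"
  shows "m4 (pauli_block Y (0\<^sub>m N N) (0\<^sub>m N N) (0\<^sub>m N N)) = sqrt 2 * m4 Y"
    and "m4 (pauli_block (0\<^sub>m N N) Y (0\<^sub>m N N) (0\<^sub>m N N)) = sqrt 2 * m4 Y"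
    and "m4 (pauli_block (0\<^sub>m N N) (0\<^sub>m N N) Y (0\<^sub>m N N)) = sqrt 2 * m4 Y"
    and "m4 (pauli_block (0\<^sub>m N N) (0\<^sub>m N N) (0\<^sub>m N N) Y) = sqrt 2 * m4 Y"
  using sq_carrier[OF Y Y] sq_carrier[OF sq_carrier[OF Y Y] sq_carrier[OF Y Y]]
  unfolding m4_def pauli_block_single_square[OF Y]
  by (simp_all add: pauli_block_single_square[of _ N] rtr_pauli_block[of _ N] real_sqrt_mult)

text \<open>The identity component keeps coefficient 1 by \<open>m4_add_centered\<close>; the other
  three are merged by two uses of \<open>m4_add\<close>, at a cost of at most 4 * 2 * 2 = 16. The
  factor \<open>sqrt 2\<close> comes from the trace 2 of the identity in the additional tensor
  factor.\<close>

lemma m4_pauli_block: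
  assumes h: "herm N X0" "herm N X1" "herm N X2" "herm N X3"
  shows "m4 (pauli_block X0 X1 X2 X3) \<le> sqrt 2 * (m4 X0 + 16 * (m4 X1 + m4 X2 + m4 X3))"
proof -
  note c = h[THEN herm_carrier]
  let ?z = "0\<^sub>m N N :: complex mat"
  let ?A = "pauli_block X0 ?z ?z ?z" and ?B = "pauli_block ?z X1 ?z ?z"
    and ?C = "pauli_block ?z ?z X2 ?z" and ?D = "pauli_block ?z ?z ?z X3"
  have hA: "herm (2 * N) ?A" and hB: "herm (2 * N) ?B" and hC: "herm (2 * N) ?C" and hD: "herm (2 * N) ?D"
    using h by (auto intro: herm_pauli_block)
  have E: "?B + (?C + ?D) = pauli_block ?z X1 X2 X3"
    using c unfolding pauli_block_def by (intro eq_matI) auto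
  have X: "pauli_block X0 X1 X2 X3 = ?A + pauli_block ?z X1 X2 X3"
    using c unfolding pauli_block_def by (intro eq_matI) auto
  \<comment> \<open>The cube of \<open>?A\<close> has only an identity component, which is
    orthogonal to the other three.\<close>
  have "rtr (?A * ?A * ?A * (pauli_block ?z X1 X2 X3)) = 0"
  proof -
    have "?A * ?A * ?A = pauli_block (X0 * X0 * X0) ?z ?z ?z"
    proof -
      have z: "c \<cdot>\<^sub>m ?z = ?z" for c by (intro eq_matI) auto
      show ?thesis
        unfolding pauli_block_single_square[OF c(1)] unfolding pauli_block_def z
        using c(1) sq_carrier[OF c(1) c(1)]
        by (subst mult_four_block_mat[of _ N N _ N _ N _ _ N _ N]) (simp_all add: sq_carrier)
    qed
    then have "rtr (?A * ?A * ?A * (pauli_block ?z X1 X2 X3)) =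
        2 * (rtr (X0 * X0 * X0 * ?z) + rtr (?z * X1) + rtr (?z * X2) + rtr (?z * X3))"
      using c by (simp add: rtr_mult_pauli_block[of _ N] sq_carrier)
    also have "\<dots> = 0"
      using c right_mult_zero_mat[OF sq_carrier[OF sq_carrier[OF c(1) c(1)] c(1)]]
      by (simp add: left_mult_zero_mat[of _ N N] rtr_def mat_trace_def)
    finally show ?thesis .
  qed
  then have "m4 (pauli_block X0 X1 X2 X3) \<le> m4 ?A + 4 * m4 (?B + (?C + ?D))"
    unfolding X E using hA herm_pauli_block[OF herm_zero h(2,3,4)] by (intro m4_add_centered)
  moreover have "m4 (?B + (?C + ?D)) \<le> 2 * (m4 ?B + m4 (?C + ?D))" "m4 (?C + ?D) \<le> 2 * (m4 ?C + m4 ?D)"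
    using m4_add[OF hB herm_add[OF hC hD]] m4_add[OF hC hD] .
  moreover note m4_nonneg[OF hB] m4_nonneg[OF hC] m4_nonneg[OF hD]
  moreover have "p \<le> a + 16 * (b + c + d)"
    if "p \<le> a + 4 * e" "e \<le> 2 * (b + f)" "f \<le> 2 * (c + d)" "0 \<le> b" for p a b c d e f :: real
    using that by simp
  ultimately have "m4 (pauli_block X0 X1 X2 X3) \<le> m4 ?A + 16 * (m4 ?B + m4 ?C + m4 ?D)" by blast
  then show ?thesis
    unfolding m4_pauli_block_single[OF c(1)] m4_pauli_block_single[OF c(2)]
      m4_pauli_block_single[OF c(3)] m4_pauli_block_single[OF c(4)] by (simp add: algebra_simps)
qed

section \<open>Pauli expansions and hypercontractivity\<close>

lemma d_map_pauli_block_first: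
  assumes c: "X0 \<in> carrier_mat (2 ^ n) (2 ^ n)" "X1 \<in> carrier_mat (2 ^ n) (2 ^ n)"
    "X2 \<in> carrier_mat (2 ^ n) (2 ^ n)" "X3 \<in> carrier_mat (2 ^ n) (2 ^ n)"
  shows "d_map (Suc n) 1 (pauli_block X0 X1 X2 X3) = pauli_block (0\<^sub>m (2 ^ n) (2 ^ n)) X1 X2 X3"
proof -
  have "(1 / 2) \<cdot>\<^sub>m ((X0 + X3) - (X0 + (- 1) \<cdot>\<^sub>m X3)) = 0\<^sub>m (2 ^ n) (2 ^ n) + X3"
    using c by (intro eq_matI) auto
  moreover have "(1 / 2) \<cdot>\<^sub>m ((X0 + (- 1) \<cdot>\<^sub>m X3) - (X0 + X3)) = 0\<^sub>m (2 ^ n) (2 ^ n) + (- 1) \<cdot>\<^sub>m X3"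
    using c by (intro eq_matI) auto
  ultimately show ?thesis
    unfolding pauli_block_def using c by (subst d_map_four_block_first) auto
qed

lemma d_map_add:
  assumes j: "1 \<le> j" "j \<le> n"
    and A: "A \<in> carrier_mat (2 ^ n) (2 ^ n)" and B: "B \<in> carrier_mat (2 ^ n) (2 ^ n)"
  shows "d_map n j (A + B) = d_map n j A + d_map n j B"
proof -
  have one: "1 \<cdot>\<^sub>m X = X" for X :: "complex mat" by (intro eq_matI) auto
  show ?thesis using d_map_linear[OF j A B, of 1] unfolding one .
qed

lemma d_map_pauli_block_later:
  assumes j: "1 \<le> j" "j \<le> n"
    and c: "X0 \<in> carrier_mat (2 ^ n) (2 ^ n)" "X1 \<in> carrier_mat (2 ^ n) (2 ^ n)"
      "X2 \<in> carrier_mat (2 ^ n) (2 ^ n)" "X3 \<in> carrier_mat (2 ^ n) (2 ^ n)"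
  shows "d_map (Suc n) (Suc j) (pauli_block X0 X1 X2 X3) =
    pauli_block (d_map n j X0) (d_map n j X1) (d_map n j X2) (d_map n j X3)"
  unfolding pauli_block_def d_map_linear[OF j c(2,3), symmetric] d_map_linear[OF j c(1,4), symmetric]
    d_map_add[OF j c(1,4), symmetric]
  using c by (intro d_map_four_block_later[OF j]) auto

text \<open>The first list entry belongs to the first tensor factor, so inductions peel off that
  factor. Real coefficients suffice because only Hermitian matrices are expanded.\<close>

fun pauli_sum :: "nat \<Rightarrow> (nat list \<Rightarrow> real) \<Rightarrow> complex mat" where
  "pauli_sum 0 a = complex_of_real (a []) \<cdot>\<^sub>m 1\<^sub>m 1"
| "pauli_sum (Suc n) a = pauli_block (pauli_sum n (\<lambda>s. a (0 # s))) (pauli_sum n (\<lambda>s. a (1 # s)))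
     (pauli_sum n (\<lambda>s. a (2 # s))) (pauli_sum n (\<lambda>s. a (3 # s)))"

definition pauli_strings :: "nat \<Rightarrow> nat list set" where
  "pauli_strings n = {s. set s \<subseteq> {..<4} \<and> length s = n}"

definition weight :: "nat list \<Rightarrow> nat" where
  "weight s = length (filter (\<lambda>k. k \<noteq> 0) s)"

lemma finite_pauli_strings [simp]: "finite (pauli_strings n)"
  unfolding pauli_strings_def by (rule finite_lists_length_eq) simp

lemma pauli_strings_0: "pauli_strings 0 = {[]}"
  unfolding pauli_strings_def by auto

lemma sum_pauli_strings_Suc:
  "(\<Sum>s\<in>pauli_strings (Suc n). f s) = (\<Sum>s\<in>pauli_strings n. f (0 # s)) + (\<Sum>s\<in>pauli_strings n. f (1 # s)) +
    (\<Sum>s\<in>pauli_strings n. f (2 # s)) + (\<Sum>s\<in>pauli_strings n. f (3 # s))"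
proof -
  have "pauli_strings (Suc n) = (\<lambda>(k, s). k # s) ` ({..<4} \<times> pauli_strings n)"
    unfolding pauli_strings_def by (auto simp: length_Suc_conv image_iff)
  then have "(\<Sum>s\<in>pauli_strings (Suc n). f s) = (\<Sum>(k, s)\<in>{..<4} \<times> pauli_strings n. f (k # s))"
    by (simp add: sum.reindex inj_on_def case_prod_beta)
  also have "\<dots> = (\<Sum>k<4. \<Sum>s\<in>pauli_strings n. f (k # s))"
    by (rule sum.cartesian_product[symmetric])
  finally show ?thesis by (simp add: numeral_eq_Suc)
qed

lemma herm_one: "herm N (1\<^sub>m N)"
  unfolding herm_def
proof
  show "mat_adjoint (1\<^sub>m N) = (1\<^sub>m N :: complex mat)" by (rule eq_matI) auto
qed simp

lemma herm_pauli_sum: "herm (2 ^ n) (pauli_sum n a)"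
proof (induct n arbitrary: a)
  case 0
  show ?case unfolding pauli_sum.simps power_0 by (rule herm_smult[OF herm_one])
next
  case (Suc n)
  show ?case unfolding pauli_sum.simps power_Suc by (intro herm_pauli_block Suc)
qed

lemma pauli_sum_carrier: "pauli_sum n a \<in> carrier_mat (2 ^ n) (2 ^ n)"
  by (rule herm_carrier[OF herm_pauli_sum])

lemma pauli_sum_zero: "pauli_sum n (\<lambda>_. 0) = 0\<^sub>m (2 ^ n) (2 ^ n)"
proof (induct n)
  case 0
  show ?case by (rule eq_matI) auto
next
  case (Suc n)
  show ?case unfolding pauli_sum.simps Suc pauli_block_def by (rule eq_matI) auto
qed

lemma pauli_Parseval:
  "rtr (pauli_sum n a * pauli_sum n b) = 2 ^ n * (\<Sum>s\<in>pauli_strings n. a s * b s)"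
proof (induct n arbitrary: a b)
  case 0
  show ?case by (simp add: pauli_strings_0 rtr_def mat_trace_def scalar_prod_def)
next
  case (Suc n)
  show ?case
    by (simp only: pauli_sum.simps rtr_mult_pauli_block[OF pauli_sum_carrier pauli_sum_carrier
          pauli_sum_carrier pauli_sum_carrier pauli_sum_carrier pauli_sum_carrier pauli_sum_carrier
          pauli_sum_carrier] Suc sum_pauli_strings_Suc) (simp add: algebra_simps)
qed

lemma rtr_pauli_sum: "rtr (pauli_sum n a) = 2 ^ n * a (replicate n 0)"
proof (induct n arbitrary: a)
  case 0
  show ?case by (simp add: rtr_def mat_trace_def)
next
  case (Suc n)
  show ?case by (simp add: rtr_pauli_block[OF pauli_sum_carrier pauli_sum_carrier] Suc)
qed

text \<open>The four Pauli components of a Hermitian matrix are again Hermitian, so the recursion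
  ends in Hermitian 1 by 1 matrices, which are real coefficients.\<close>

lemma pauli_expansion:
  assumes "herm (2 ^ n) A"
  shows "\<exists>a. A = pauli_sum n a"
  using assms
proof (induct n arbitrary: A)
  case 0
  have "A = pauli_sum 0 (\<lambda>_. Re (A $$ (0, 0)))"
    using herm_carrier[OF 0] herm_diag[OF 0, of 0] by (intro eq_matI) (auto simp: complex_eq_iff)
  then show ?case by blast
next
  case (Suc n)
  let ?N = "2 ^ n :: nat"
  have h: "A $$ (i, j) = cnj (A $$ (j, i))" if "i < 2 * ?N" "j < 2 * ?N" for i j
    by (rule herm_index[OF Suc(2)]) (use that in simp_all)
  have A: "A \<in> carrier_mat (2 * ?N) (2 * ?N)" using herm_carrier[OF Suc(2)] by simp
  define g where "g i = ?N + i" for i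
  \<comment> \<open>These matrices solve the block equations of \<open>pauli_block\<close>; for
    instance, \<open>X1 - i X2\<close> is the upper right block and \<open>X1 + i X2\<close> the
    lower left one.\<close>
  define X0 where "X0 = mat ?N ?N (\<lambda>(i, j). (A $$ (i, j) + A $$ (g i, g j)) / 2)"
  define X1 where "X1 = mat ?N ?N (\<lambda>(i, j). (A $$ (i, g j) + A $$ (g i, j)) / 2)"
  define X2 where "X2 = mat ?N ?N (\<lambda>(i, j). \<i> * (A $$ (i, g j) - A $$ (g i, j)) / 2)"
  define X3 where "X3 = mat ?N ?N (\<lambda>(i, j). (A $$ (i, j) - A $$ (g i, g j)) / 2)"
  note defs = X0_def X1_def X2_def X3_def
  have herm: "herm ?N X" if "X \<in> carrier_mat ?N ?N"
    "\<And>i j. i < ?N \<Longrightarrow> j < ?N \<Longrightarrow> cnj (X $$ (j, i)) = X $$ (i, j)" for X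
    unfolding herm_def using that by (auto intro!: eq_matI)
  have hs: "cnj (A $$ (j, i)) = A $$ (i, j)" "cnj (A $$ (g j, i)) = A $$ (i, g j)"
    "cnj (A $$ (j, g i)) = A $$ (g i, j)" "cnj (A $$ (g j, g i)) = A $$ (g i, g j)"
    if "i < ?N" "j < ?N" for i j
    using that h[of i j] h[of i "g j"] h[of "g i" j] h[of "g i" "g j"]
    by (simp_all add: g_def)
  have "herm ?N X0" "herm ?N X1" "herm ?N X2" "herm ?N X3"
    by (rule herm; simp add: defs hs algebra_simps diff_divide_distrib)+
  then obtain a0 a1 a2 a3 where a: "X0 = pauli_sum n a0" "X1 = pauli_sum n a1"
    "X2 = pauli_sum n a2" "X3 = pauli_sum n a3"
    using Suc(1) by metis
  define a where "a s = (case s of [] \<Rightarrow> 0 | k # t \<Rightarrow>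
    if k = 0 then a0 t else if k = 1 then a1 t else if k = 2 then a2 t else a3 t)" for s :: "nat list"
  have "A = pauli_block X0 X1 X2 X3"
  proof (rule eq_matI)
    fix i j assume "i < dim_row (pauli_block X0 X1 X2 X3)" "j < dim_col (pauli_block X0 X1 X2 X3)"
    then have ij: "i < 2 * ?N" "j < 2 * ?N" by (simp_all add: pauli_block_def defs)
    have i2: "\<i> * (\<i> * x) = - x" for x :: complex
      by (simp add: mult.assoc[symmetric])
    show "A $$ (i, j) = pauli_block X0 X1 X2 X3 $$ (i, j)"
      using ij unfolding pauli_block_def defs g_def
      by (cases "i < ?N"; cases "j < ?N") (simp_all add: i2 field_simps)
  qed (use A in \<open>simp_all add: pauli_block_def defs\<close>)
  also have "\<dots> = pauli_sum (Suc n) a"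
    by (simp add: a a_def)
  finally show ?case by blast
qed

lemma d_map_pauli_sum:
  assumes "1 \<le> j" "j \<le> n"
  shows "d_map n j (pauli_sum n a) = pauli_sum n (\<lambda>s. if s ! (j - 1) = 0 then 0 else a s)"
  using assms
proof (induct n arbitrary: j a)
  case 0
  then show ?case by simp
next
  case (Suc n)
  show ?case
  proof (cases "j = 1")
    case True
    show ?thesis
      unfolding True pauli_sum.simps
        d_map_pauli_block_first[OF pauli_sum_carrier pauli_sum_carrier pauli_sum_carrier pauli_sum_carrier]
      by (simp add: pauli_sum_zero)
  next
    case False
    then obtain i where i: "j = Suc i" "1 \<le> i" "i \<le> n" using Suc(2,3) by (cases j) auto
    \<comment> \<open>Tensor factors are counted from 1 and list positions from 0; removing the head
      shifts both by one.\<close>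
    have "(k # s) ! (j - 1) = s ! (i - 1)" for k :: nat and s using i by (simp add: nth_Cons')
    then show ?thesis
      unfolding pauli_sum.simps unfolding i(1)
        d_map_pauli_block_later[OF i(2,3) pauli_sum_carrier pauli_sum_carrier pauli_sum_carrier pauli_sum_carrier]
        Suc(1)[OF i(2,3)] by simp
  qed
qed

text \<open>The noise rate \<open>1/4\<close> cancels the factor \<open>16\<close> of \<open>m4_pauli_block\<close>.\<close>

theorem hypercontractivity:
  "m4 (pauli_sum n (\<lambda>s. (1 / 4) ^ weight s * a s)) \<le> sqrt (2 ^ n) * (\<Sum>s\<in>pauli_strings n. (a s)\<^sup>2)"
proof (induct n arbitrary: a)
  case 0
  show ?case by (simp add: m4_def weight_def pauli_strings_0 rtr_def mat_trace_def scalar_prod_def power2_eq_square)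
next
  case (Suc n)
  let ?T = "\<lambda>a. pauli_sum n (\<lambda>s. (1 / 4) ^ weight s * a s)" and ?S = "\<lambda>a. \<Sum>s\<in>pauli_strings n. (a s)\<^sup>2"
  \<comment> \<open>A nonzero first letter puts its factor 1/4 into the coefficients, where the
    induction hypothesis squares it to 1/16.\<close>
  have w: "(1 / 4) ^ weight (0 # s) * x = (1 / 4) ^ weight s * x"
    "k \<noteq> 0 \<Longrightarrow> (1 / 4) ^ weight (k # s) * x = (1 / 4) ^ weight s * (1 / 4 * x)" for k s and x :: real
    by (simp_all add: weight_def)
  have S: "?S (\<lambda>s. 1 / 4 * b s) = 1 / 16 * ?S b" for b :: "nat list \<Rightarrow> real"
    unfolding sum_distrib_left by (intro sum.cong refl) (simp add: power2_eq_square)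
  have IH: "m4 (?T (\<lambda>s. 1 / 4 * b s)) \<le> sqrt (2 ^ n) * (1 / 16 * ?S b)" for b
    using Suc[of "\<lambda>s. 1 / 4 * b s"] unfolding S .
  have eq: "pauli_sum (Suc n) (\<lambda>s. (1 / 4) ^ weight s * a s) = pauli_block (?T (\<lambda>s. a (0 # s)))
      (?T (\<lambda>s. 1 / 4 * a (1 # s))) (?T (\<lambda>s. 1 / 4 * a (2 # s))) (?T (\<lambda>s. 1 / 4 * a (3 # s)))"
    unfolding pauli_sum.simps by (simp only: w numeral_eq_Suc One_nat_def nat.distinct not_False_eq_True simp_thms)
  have "m4 (pauli_sum (Suc n) (\<lambda>s. (1 / 4) ^ weight s * a s)) \<le> sqrt 2 * (m4 (?T (\<lambda>s. a (0 # s))) +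
      16 * (m4 (?T (\<lambda>s. 1 / 4 * a (1 # s))) + m4 (?T (\<lambda>s. 1 / 4 * a (2 # s))) + m4 (?T (\<lambda>s. 1 / 4 * a (3 # s)))))"
    unfolding eq by (intro m4_pauli_block[of "2 ^ n"] herm_pauli_sum)
  also have "\<dots> \<le> sqrt 2 * (sqrt (2 ^ n) * ?S (\<lambda>s. a (0 # s)) +
      16 * (sqrt (2 ^ n) * (1 / 16 * ?S (\<lambda>s. a (1 # s))) + sqrt (2 ^ n) * (1 / 16 * ?S (\<lambda>s. a (2 # s))) +
      sqrt (2 ^ n) * (1 / 16 * ?S (\<lambda>s. a (3 # s)))))"
    by (intro mult_left_mono add_mono Suc IH) simp_all
  also have "\<dots> = sqrt (2 ^ Suc n) * (\<Sum>s\<in>pauli_strings (Suc n). (a s)\<^sup>2)"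
    unfolding sum_pauli_strings_Suc power_Suc real_sqrt_mult by (simp add: algebra_simps)
  finally show ?case .
qed

section \<open>Influences of a projection and the variance bound\<close>

text \<open>A string survives under exactly \<open>weight s\<close> of the maps \<open>d_j\<close>;
  this is the double count behind the summation over \<open>j\<close>.\<close>

lemma weight_eq_sum:
  assumes "length s = n"
  shows "(\<Sum>j\<in>{1..n}. if s ! (j - 1) = 0 then 0 else c) = real (weight s) * c"
proof -
  have "(\<Sum>j\<in>{1..n}. if s ! (j - 1) = 0 then 0 else c) = (\<Sum>i<n. if s ! i = 0 then 0 else c)"
    by (rule sum.reindex_bij_witness[of _ Suc "\<lambda>j. j - 1"]) auto
  also have "\<dots> = (\<Sum>i\<in>{i. i < n \<and> s ! i \<noteq> 0}. c)"
    by (rule sum.mono_neutral_cong_right) auto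
  finally show ?thesis using assms by (simp add: weight_def length_filter_conv_card)
qed

lemma weight_pos:
  assumes "length s = n" "s \<noteq> replicate n 0"
  shows "1 \<le> weight s"
proof (rule ccontr)
  assume "\<not> 1 \<le> weight s"
  then have "filter (\<lambda>k. k \<noteq> 0) s = []" unfolding weight_def by (cases "filter (\<lambda>k. k \<noteq> 0) s") auto
  then have "\<forall>k\<in>set s. k = 0" unfolding filter_empty_conv by blast
  then have "s = replicate n 0" using assms(1) by (metis replicate_length_same)
  with assms(2) show False ..
qed

lemma projection_influence:
  assumes P: "herm (2 ^ n) P" "P * P = P" "P = pauli_sum n p" and j: "1 \<le> j" "j \<le> n"
  defines "q \<equiv> \<lambda>s. if s ! (j - 1) = 0 then 0 else p s" and "I \<equiv> norm1 n (d_map n j P)"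
  shows "(\<Sum>s\<in>pauli_strings n. (q s)\<^sup>2) \<le> I"
    and "(\<Sum>s\<in>pauli_strings n. (1 / 16) ^ weight s * (q s)\<^sup>2) \<le> sqrt (I ^ 3)"
    and "0 \<le> I"
proof -
  define A where "A = d_map n j P"
  have Aq: "A = pauli_sum n q" unfolding A_def P(3) q_def by (rule d_map_pauli_sum[OF j])
  have A: "herm (2 ^ n) A" unfolding Aq by (rule herm_pauli_sum)
  have I': "I = rtr (mat_abs A) / 2 ^ n" unfolding I_def A_def norm1_def rtr_def ..
  then have I: "rtr (mat_abs A) = 2 ^ n * I" by simp
  show I0: "0 \<le> I" unfolding I' using trace_norm_nonneg[OF A] by simp
  define E where "E = (\<Sum>s\<in>pauli_strings n. (q s)\<^sup>2)"
  have E0: "0 \<le> E" unfolding E_def by (simp add: sum_nonneg)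
  have "rtr (P * A) = 2 ^ n * (\<Sum>s\<in>pauli_strings n. p s * q s)"
    unfolding Aq P(3) by (rule pauli_Parseval)
  \<comment> \<open>\<open>q\<close> is \<open>p\<close> restricted to the strings that
    \<open>d_j\<close> keeps, so pairing with \<open>p\<close> already yields the sum of
    squares.\<close>
  also have "(\<Sum>s\<in>pauli_strings n. p s * q s) = E"
    unfolding E_def by (intro sum.cong) (auto simp: q_def power2_eq_square)
  finally have "2 ^ n * E \<le> 2 ^ n * I" using trace_norm_dual_projection[OF A P(1,2)] I by simp
  then have EI: "E \<le> I" by (rule mult_left_le_imp_le) simp
  then show "(\<Sum>s\<in>pauli_strings n. (q s)\<^sup>2) \<le> I" unfolding E_def .
  define x where "x = (\<Sum>s\<in>pauli_strings n. (1 / 16) ^ weight s * (q s)\<^sup>2)"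
  have x0: "0 \<le> x" unfolding x_def by (simp add: sum_nonneg)
  \<comment> \<open>Let \<open>T\<close> scale each Pauli string by
    \<open>(1 / 4) ^ weight s\<close>. Then \<open>b\<close> holds the coefficients of
    \<open>T A\<close>, and \<open>C\<close> is \<open>T (T A)\<close>. Up to powers of
    \<open>2 ^ n\<close>, the pairing of \<open>C\<close> with \<open>A\<close> is \<open>x\<close>,
    and hypercontractivity bounds \<open>m4 C\<close> by the squared 2-norm of \<open>T A\<close>,
    which is \<open>x\<close> again.\<close>
  define b where "b s = (1 / 4) ^ weight s * q s" for s
  define C where "C = pauli_sum n (\<lambda>s. (1 / 4) ^ weight s * b s)"
  have C: "herm (2 ^ n) C" unfolding C_def by (rule herm_pauli_sum)
  have pw: "(1 / 4) ^ k * (1 / 4) ^ k = (1 / 16 :: real) ^ k" for k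
    unfolding power_mult_distrib[symmetric] by simp
  have b2: "(b s)\<^sup>2 = (1 / 16) ^ weight s * (q s)\<^sup>2" for s
    unfolding b_def power2_eq_square pw[symmetric] by (simp only: mult_ac)
  have "(1 / 4) ^ weight s * b s * q s = (1 / 16) ^ weight s * (q s)\<^sup>2" for s
    unfolding b_def power2_eq_square pw[symmetric] by (simp only: mult_ac)
  then have CA: "rtr (C * A) = 2 ^ n * x"
    unfolding C_def Aq pauli_Parseval x_def by simp
  have AA: "rtr (A * A) = 2 ^ n * E"
    unfolding Aq pauli_Parseval E_def by (simp add: power2_eq_square)
  have "m4 C \<le> sqrt (2 ^ n) * x"
    using hypercontractivity[of n b] unfolding C_def b2 x_def .
  then have "(m4 C)\<^sup>2 \<le> (sqrt (2 ^ n) * x)\<^sup>2"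
    using m4_nonneg[OF C] by (intro power_mono) auto
  then have C4: "rtr (C * C * (C * C)) \<le> 2 ^ n * x\<^sup>2"
    unfolding m4_square[OF C] power_mult_distrib by simp
  have "(2 ^ n * x) ^ 4 \<le> (2 ^ n * I)\<^sup>2 * (2 ^ n * E) * rtr (C * C * (C * C))"
    using trace_norm_interpolation[OF A C] unfolding CA AA I .
  also have "\<dots> \<le> (2 ^ n * I)\<^sup>2 * (2 ^ n * E) * (2 ^ n * x\<^sup>2)"
    using C4 E0 by (intro mult_left_mono) auto
  \<comment> \<open>Replacing \<open>E\<close> by \<open>I\<close> leaves a bound in
    \<open>I\<close> and \<open>x\<close> alone; there are four factors \<open>2 ^ n\<close> on
    either side, so they cancel.\<close>
  also have "\<dots> \<le> (2 ^ n * I)\<^sup>2 * (2 ^ n * I) * (2 ^ n * x\<^sup>2)"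
    using EI by (intro mult_left_mono mult_right_mono) auto
  finally have "(2 ^ n) ^ 4 * (x\<^sup>2 * x\<^sup>2) \<le> (2 ^ n) ^ 4 * (I ^ 3 * x\<^sup>2)"
    by (simp add: power_mult_distrib power2_eq_square power4_eq_xxxx power3_eq_cube mult_ac)
  then have le: "x\<^sup>2 * x\<^sup>2 \<le> I ^ 3 * x\<^sup>2" by (simp only: mult_le_cancel_left_pos zero_less_power zero_less_numeral)
  have "x\<^sup>2 \<le> I ^ 3"
  proof (cases "x = 0")
    case True
    then show ?thesis using I0 by simp
  next
    case False
    then show ?thesis using mult_right_le_imp_le[OF le] by simp
  qed
  then show "(\<Sum>s\<in>pauli_strings n. (1 / 16) ^ weight s * (q s)\<^sup>2) \<le> sqrt (I ^ 3)"
    unfolding x_def[symmetric] by (rule real_le_rsqrt)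
qed

text \<open>For weights at least \<open>K\<close> the first term is at least 1. Below
  \<open>K\<close> the second one is, since \<open>16 powr (K - w)\<close> and \<open>w\<close> are
  both at least 1.\<close>

lemma weight_tradeoff:
  fixes K :: real
  assumes "1 \<le> w" "0 < K"
  shows "1 \<le> real w / K + real w * (1 / 16) ^ w * 16 powr K"
proof (cases "K \<le> real w")
  case True
  then have "1 \<le> real w / K" using assms by simp
  then show ?thesis by (simp add: add_increasing2)
next
  case False
  have "(1 / 16 :: real) ^ w * 16 powr K = 16 powr (K - real w)"
    using powr_diff[of 16 K "real w"] powr_realpow[of 16 w] by (simp only: power_one_over) simp
  moreover have "1 \<le> 16 powr (K - real w)" using False by (intro ge_one_powr_ge_zero) auto
  ultimately have "1 * 1 \<le> real w * ((1 / 16) ^ w * 16 powr K)" using assms by (intro mult_mono) auto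
  moreover have "0 \<le> real w / K" using assms by simp
  ultimately show ?thesis by (simp add: mult.assoc)
qed

text \<open>Each nonidentity string is charged by \<open>weight_tradeoff\<close> to the two
  influence estimates, summed over \<open>j\<close>. The threshold \<open>K\<close> stays free, to
  be fitted to the size of the variance later.\<close>

lemma projection_variance_bound:
  assumes P: "herm (2 ^ n) P" "P * P = P" and n: "1 \<le> n" and K: "0 < K"
  defines "t \<equiv> rtr P / 2 ^ n" and "M \<equiv> (MAX j\<in>{1..n}. norm1 n (d_map n j P))"
  shows "0 \<le> M" and "0 \<le> t * (1 - t)"
    and "t * (1 - t) \<le> real n * M / K + 16 powr K * (real n * sqrt (M ^ 3))"
proof -
  obtain p where p: "P = pauli_sum n p" using pauli_expansion[OF P(1)] by auto
  let ?S = "pauli_strings n"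
  define q where "q j s = (if s ! (j - 1) = 0 then 0 else p s)" for j :: nat and s
  have IM: "norm1 n (d_map n j P) \<le> M" if "j \<in> {1..n}" for j
    unfolding M_def using that by (intro Max_ge) auto
  have inf: "(\<Sum>s\<in>?S. (q j s)\<^sup>2) \<le> M" "(\<Sum>s\<in>?S. (1 / 16) ^ weight s * (q j s)\<^sup>2) \<le> sqrt (M ^ 3)" "0 \<le> M"
    if "j \<in> {1..n}" for j
  proof -
    have j: "1 \<le> j" "j \<le> n" using that by auto
    note I = projection_influence[OF P p j, folded q_def] and le = IM[OF that]
    show "(\<Sum>s\<in>?S. (q j s)\<^sup>2) \<le> M" using I(1) le by simp
    show "0 \<le> M" using I(3) le by simp
    have "sqrt (norm1 n (d_map n j P) ^ 3) \<le> sqrt (M ^ 3)"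
      using I(3) le by (intro real_sqrt_le_mono power_mono)
    then show "(\<Sum>s\<in>?S. (1 / 16) ^ weight s * (q j s)\<^sup>2) \<le> sqrt (M ^ 3)" using I(2) by linarith
  qed
  show "0 \<le> M" using inf(3)[of 1] n by simp
  have len: "length s = n" if "s \<in> ?S" for s using that unfolding pauli_strings_def by simp
  have total: "(\<Sum>j\<in>{1..n}. \<Sum>s\<in>?S. c s * (q j s)\<^sup>2) = (\<Sum>s\<in>?S. real (weight s) * (c s * (p s)\<^sup>2))" for c
  proof -
    have "(\<Sum>j\<in>{1..n}. \<Sum>s\<in>?S. c s * (q j s)\<^sup>2) =
        (\<Sum>s\<in>?S. \<Sum>j\<in>{1..n}. if s ! (j - 1) = 0 then 0 else c s * (p s)\<^sup>2)"
      by (subst sum.swap) (auto simp: q_def intro!: sum.cong)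
    also have "\<dots> = (\<Sum>s\<in>?S. real (weight s) * (c s * (p s)\<^sup>2))"
      by (intro sum.cong refl weight_eq_sum len)
    finally show ?thesis .
  qed
  have "(\<Sum>j\<in>{1..n}. \<Sum>s\<in>?S. 1 * (q j s)\<^sup>2) \<le> (\<Sum>j\<in>{1..n}. M)"
    using inf(1) by (intro sum_mono) simp
  then have W1: "(\<Sum>s\<in>?S. real (weight s) * (p s)\<^sup>2) \<le> real n * M"
    unfolding total by simp
  have "(\<Sum>j\<in>{1..n}. \<Sum>s\<in>?S. (1 / 16) ^ weight s * (q j s)\<^sup>2) \<le> (\<Sum>j\<in>{1..n}. sqrt (M ^ 3))"
    using inf(2) by (intro sum_mono) simp
  then have W2: "(\<Sum>s\<in>?S. real (weight s) * ((1 / 16) ^ weight s * (p s)\<^sup>2)) \<le> real n * sqrt (M ^ 3)"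
    unfolding total by simp
  \<comment> \<open>The identity coefficient is \<open>t\<close>, and idempotence makes Parseval say
    that \<open>t\<close> is the sum of all squared coefficients; the other strings therefore carry
    \<open>t - t\<^sup>2\<close>.\<close>
  have t: "t = p (replicate n 0)" unfolding t_def p rtr_pauli_sum by simp
  have "rtr (P * P) = 2 ^ n * (\<Sum>s\<in>?S. p s * p s)" unfolding p by (rule pauli_Parseval)
  then have t2: "t = (\<Sum>s\<in>?S. (p s)\<^sup>2)" unfolding P(2) t_def by (simp add: power2_eq_square)
  have "replicate n 0 \<in> ?S" unfolding pauli_strings_def by auto
  then have "(\<Sum>s\<in>?S. (p s)\<^sup>2) = (p (replicate n 0))\<^sup>2 + (\<Sum>s\<in>?S - {replicate n 0}. (p s)\<^sup>2)"
    by (intro sum.remove) auto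
  then have v: "t * (1 - t) = (\<Sum>s\<in>?S - {replicate n 0}. (p s)\<^sup>2)"
    using t t2 by (simp add: power2_eq_square algebra_simps)
  show "0 \<le> t * (1 - t)" unfolding v by (simp add: sum_nonneg)
  have "t * (1 - t) \<le> (\<Sum>s\<in>?S - {replicate n 0}. real (weight s) * (p s)\<^sup>2 / K +
      16 powr K * (real (weight s) * ((1 / 16) ^ weight s * (p s)\<^sup>2)))"
    unfolding v
  proof (intro sum_mono)
    fix s assume "s \<in> ?S - {replicate n 0}"
    then have "1 \<le> weight s" using weight_pos[OF len] by auto
    from mult_right_mono[OF weight_tradeoff[OF this K] zero_le_power2[of "p s"]]
    show "(p s)\<^sup>2 \<le> real (weight s) * (p s)\<^sup>2 / K +
      16 powr K * (real (weight s) * ((1 / 16) ^ weight s * (p s)\<^sup>2))"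
      by (simp add: algebra_simps)
  qed
  \<comment> \<open>All terms are nonnegative, so the identity string may be put back.\<close>
  also have "\<dots> \<le> (\<Sum>s\<in>?S. real (weight s) * (p s)\<^sup>2 / K +
      16 powr K * (real (weight s) * ((1 / 16) ^ weight s * (p s)\<^sup>2)))"
    using K by (intro sum_mono2) auto
  also have "\<dots> = (\<Sum>s\<in>?S. real (weight s) * (p s)\<^sup>2) / K +
      16 powr K * (\<Sum>s\<in>?S. real (weight s) * ((1 / 16) ^ weight s * (p s)\<^sup>2))"
    by (simp add: sum.distrib sum_divide_distrib sum_distrib_left)
  also have "\<dots> \<le> real n * M / K + 16 powr K * (real n * sqrt (M ^ 3))"
    using W1 W2 K by (intro add_mono divide_right_mono mult_left_mono) auto
  finally show "t * (1 - t) \<le> real n * M / K + 16 powr K * (real n * sqrt (M ^ 3))" .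
qed

section \<open>Choice of the threshold and conclusion\<close>

text \<open>If \<open>M\<close> were smaller, a threshold proportional to \<open>ln (n / v)\<close>
  would make each of the two terms of \<open>bound\<close> at most \<open>v / 4\<close>,
  contradicting positivity of \<open>v\<close>.\<close>

lemma log_lower_bound:
  fixes n v M :: real
  assumes n: "1 \<le> n" and v: "0 < v" "v \<le> 1 / 4" and M: "0 \<le> M"
    and bound: "\<And>K. 0 < K \<Longrightarrow> v \<le> n * M / K + 16 powr K * (n * sqrt (M ^ 3))"
  shows "1 / 64 / n * v * sqrt (ln (n / v)) \<le> M"
proof (rule ccontr)
  define L where "L = ln (n / v)"
  define u where "u = sqrt L"
  assume "\<not> ?thesis"
  then have Mu: "M < 1 / 64 / n * v * u" unfolding u_def L_def by simp
  \<comment> \<open>The bound 1/4 on \<open>v\<close> keeps \<open>n / v\<close> above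
    \<open>exp 1\<close>, so that \<open>L\<close> and \<open>u\<close> are at least 1 and
    \<open>u\<close> is at most \<open>L\<close>.\<close>
  have "4 \<le> n / v" using n v by (simp add: field_simps)
  then have "exp 1 \<le> n / v" using exp_le by linarith
  then have L1: "1 \<le> L" unfolding L_def using n v by (simp add: ln_ge_iff)
  then have u1: "1 \<le> u" and uL: "u\<^sup>2 = L" unfolding u_def by auto
  have eL: "exp L = n / v" unfolding L_def using n v by simp
  have l16: "0 < ln (16::real)" "ln (16::real) \<le> 4"
  proof -
    have "ln (16::real) = ln (2 ^ 4)" by simp
    also have "\<dots> = 4 * ln 2" by (subst ln_realpow) auto
    finally show "ln (16::real) \<le> 4" using ln_le_minus_one[of "2::real"] by simp
  qed simp
  \<comment> \<open>Chosen so that \<open>16 powr K\<close> is the fourth root of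
    \<open>n / v\<close>: small enough to be absorbed by the extra half power of \<open>M\<close> in
    the second term, yet proportional to \<open>L\<close> for the first.\<close>
  define K where "K = L / (4 * ln 16)"
  have K: "0 < K" unfolding K_def using L1 l16 by simp
  have pK: "16 powr K = exp (L / 4)"
    unfolding K_def powr_def using l16 by simp
  have first: "n * M / K < v / 4"
  proof -
    have "n * M < v * u / 64" using Mu n by (simp add: field_simps)
    then have "n * M / K < v * u / 64 / K" using K by (rule divide_strict_right_mono)
    also have "\<dots> = v * (u * ln 16) / (16 * L)" unfolding K_def using l16 by simp
    also have "\<dots> \<le> v * (L * 4) / (16 * L)"
    proof -
      have "u \<le> L" using u1 unfolding uL[symmetric] by (simp add: power2_eq_square)
      then have "u * ln 16 \<le> L * 4" using l16 u1 L1 by (intro mult_mono) auto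
      then show ?thesis using v L1 by (intro divide_right_mono mult_left_mono) auto
    qed
    also have "\<dots> = v / 4" using L1 by simp
    finally show ?thesis .
  qed
  have second: "16 powr K * (n * sqrt (M ^ 3)) \<le> v / 4"
  proof -
    \<comment> \<open>The estimate is proved in squared form. One of the three factors
      \<open>v / n\<close> is \<open>exp (- L)\<close>, which outweighs \<open>exp (L / 2)\<close>
      and the powers of \<open>u\<close>; the number 262144 is \<open>64 ^ 3\<close>.\<close>
    have "M ^ 3 * exp (L / 2) \<le> (1 / 64 / n * v * u) ^ 3 * exp (L / 2)"
      using M Mu by (intro mult_right_mono power_mono) auto
    also have "\<dots> = (v / n)\<^sup>2 * (1 / 262144 * (u ^ 3 * (exp (- L) * exp (L / 2))))"
    proof -
      have "exp (- L) = v / n" using eL by (simp add: exp_minus)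
      then show ?thesis by (simp add: power3_eq_cube power2_eq_square mult_ac)
    qed
    also have "\<dots> \<le> (v / n)\<^sup>2 * (1 / 262144 * 8)"
    proof -
      have "u ^ 3 \<le> u ^ 4" using u1 by (intro power_increasing) auto
      also have "u ^ 4 = L\<^sup>2" unfolding uL[symmetric] by simp
      \<comment> \<open>The quadratic Taylor term of the exponential at \<open>L / 2\<close> is
        \<open>L\<^sup>2 / 8\<close>.\<close>
      also have "\<dots> \<le> 8 * exp (L / 2)"
        using exp_lower_Taylor_quadratic[of "L / 2"] L1 by (simp add: power2_eq_square)
      finally have "u ^ 3 * exp (- L / 2) \<le> 8 * exp (L / 2) * exp (- L / 2)"
        by (intro mult_right_mono) auto
      also have "\<dots> = 8" by (simp add: exp_add[symmetric] mult.assoc)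
      also have "exp (- L / 2) = exp (- L) * exp (L / 2)"
        unfolding exp_add[symmetric] by simp
      finally show ?thesis by (intro mult_left_mono) auto
    qed
    also have "\<dots> \<le> (v / n)\<^sup>2 * (1 / 16)" by (intro mult_left_mono) auto
    also have "\<dots> = (v / (4 * n))\<^sup>2" by (simp add: power2_eq_square)
    finally have "sqrt (M ^ 3 * exp (L / 2)) \<le> v / (4 * n)"
      using v n by (intro real_le_lsqrt) auto
    moreover have "sqrt (M ^ 3 * exp (L / 2)) = sqrt (M ^ 3) * exp (L / 4)"
    proof -
      have "exp (L / 2) = (exp (L / 4))\<^sup>2" unfolding power2_eq_square exp_add[symmetric] by simp
      then show ?thesis by (simp add: real_sqrt_mult)
    qed
    ultimately have "n * (sqrt (M ^ 3) * exp (L / 4)) \<le> n * (v / (4 * n))"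
      using n by (intro mult_left_mono) auto
    then show ?thesis unfolding pK using n by (simp add: mult_ac)
  qed
  have "v < v / 4 + v / 4" using bound[OF K] add_less_le_mono[OF first second] by (rule le_less_trans)
  then show False using v by simp
qed

theorem theorem6p12:
  shows "\<exists>C::real. C > 0 \<and> (\<forall>n::nat. n \<ge> 1 \<longrightarrow> (\<forall>W. is_subspace n W \<longrightarrow>
    (MAX j\<in>{1..n}. norm1 n (d_map n j (orth_proj n W))) \<ge>
      C / real n * (tau n W * (1 - tau n W)) * sqrt (ln (real n / (tau n W * (1 - tau n W))))))"
proof (intro exI[of _ "1 / 64"] conjI allI impI)
  fix n :: nat and W assume n: "1 \<le> n" and W: "is_subspace n W"
  let ?M = "MAX j\<in>{1..n}. norm1 n (d_map n j (orth_proj n W))"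
  have P: "herm (2 ^ n) (orth_proj n W)" "orth_proj n W * orth_proj n W = orth_proj n W"
    using orth_proj_properties[OF W] by auto
  have tau: "rtr (orth_proj n W) / 2 ^ n = tau n W" unfolding tau_def rtr_def ..
  note B = projection_variance_bound[OF P n, unfolded tau]
  \<comment> \<open>Any positive \<open>K\<close> yields nonnegativity of the maximum; 1 is
    taken.\<close>
  have M0: "0 \<le> ?M" using B(1)[of 1] by simp
  show "1 / 64 / real n * (tau n W * (1 - tau n W)) * sqrt (ln (real n / (tau n W * (1 - tau n W)))) \<le> ?M"
  proof (cases "tau n W * (1 - tau n W) = 0")
    \<comment> \<open>For \<open>tau n W\<close> equal to 0 or 1 the vanishing prefactor makes the
      right-hand side 0 (division by zero also yields 0), in agreement with the convention for these
      values.\<close>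
    case True
    show ?thesis unfolding True using M0 by simp
  next
    case False
    then have pos: "0 < tau n W * (1 - tau n W)"
      using B(2)[of 1] by (simp add: less_le)
    have le: "tau n W * (1 - tau n W) \<le> 1 / 4"
      using zero_le_power2[of "tau n W - 1 / 2"] by (simp add: power2_eq_square algebra_simps)
    show ?thesis
      by (rule log_lower_bound[OF _ pos le M0 B(3)]) (use n in simp_all)
  qed
qed simp

end
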